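(* Let $p,K\ge 1$ be integers, let $\boldsymbol S\in\mathbb C^{p\times p}$ be a covariance matrix (Hermitian positive semidefinite), and let $\boldsymbol J_0,\ldots,\boldsymbol J_{K-1}$ be independent and identically distributed random vectors, each distributed as $\mathcal N_p^C\{\boldsymbol 0,\boldsymbol S\}$. Put $\hat{\boldsymbol S}_k=\boldsymbol J_k\boldsymbol J_k^H$ and $\hat{\boldsymbol S}=\frac1K\sum_{k=0}^{K-1}\hat{\boldsymbol S}_k$. Then the Rao-Blackwell shrinkage parameter $$\hat\rho_{\rm RB}=E\{\hat\rho_{\rm LW}\mid\hat{\boldsymbol S}\}=\frac{E\left\{\sum_{k=0}^{K-1}\|\hat{\boldsymbol S}_k-\hat{\boldsymbol S}\|_{\rm F}^2\,\Big|\,\hat{\boldsymbol S}\right\}}{K^2\left[\mathrm{tr}\{\hat{\boldsymbol S}^2\}-(\mathrm{tr}^2\{\hat{\boldsymbol S}\}/p)\right]}$$ takes the form (almost surely) $$\hat\rho_{\rm RB}=\frac{\mathrm{tr}^2\{\hat{\boldsymbol S}\}-(\mathrm{tr}\{\hat{\boldsymbol S}^2\}/K)}{(K+1)\left[\mathrm{tr}\{\hat{\boldsymbol S}^2\}-(\mathrm{tr}^2\{\hat{\boldsymbol S}\}/p)\right]}.$$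
   Context: $\mathcal N_p^C\{\boldsymbol 0,\boldsymbol S\}$ denotes the zero-mean circularly-symmetric $p$-variate complex Gaussian distribution with covariance matrix $E\{\boldsymbol J\boldsymbol J^H\}=\boldsymbol S$ (and $E\{\boldsymbol J\boldsymbol J^T\}=\boldsymbol 0$). $^H$ is conjugate transpose, $\mathrm{tr}$ is the trace, $\mathrm{tr}^2\{\boldsymbol A\}=(\mathrm{tr}\{\boldsymbol A\})^2$, and $\|\boldsymbol A\|_{\rm F}=[\mathrm{tr}\{\boldsymbol A\boldsymbol A^H\}]^{1/2}$ is the Frobenius norm. The Ledoit-Wolf shrinkage parameter is $$\hat\rho_{\rm LW}=\frac{\sum_{k=0}^{K-1}\|\hat{\boldsymbol S}_k-\hat{\boldsymbol S}\|_{\rm F}^2}{K^2\left[\mathrm{tr}\{\hat{\boldsymbol S}^2\}-(\mathrm{tr}^2\{\hat{\boldsymbol S}\}/p)\right]}.$$ The ratios are considered where the ($\hat{\boldsymbol S}$-measurable) denominator is nonzero. Conditional expectations given $\hat{\boldsymbol S}$ are with respect to the $\sigma$-algebra generated by $\hat{\boldsymbol S}$. *)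

theory Defs
  imports "HOL-Probability.Probability"
begin

section \<open>Complex matrices\<close>

definition ctranspose :: "complex^'n^'m \<Rightarrow> complex^'m^'n" where
  "ctranspose A = (\<chi> i j. cnj (A $ j $ i))"

definition hermitian :: "complex^'n^'n \<Rightarrow> bool" where
  "hermitian A \<longleftrightarrow> ctranspose A = A"

definition hermitian_psd :: "complex^'n^'n \<Rightarrow> bool" where
  "hermitian_psd A \<longleftrightarrow> hermitian A \<and> (\<forall>x. 0 \<le> Re (\<Sum>i\<in>UNIV. cnj (x $ i) * (A *v x) $ i))"

text \<open>The real part loses nothing for the Hermitian matrices considered here:
  see \<open>hermitian_trace\<close> and \<open>hermitian_trace_square\<close> below.\<close>

definition rtrace :: "complex^'n^'n \<Rightarrow> real" where
  "rtrace A = Re (trace A)"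

definition frobenius_norm :: "complex^'n^'m \<Rightarrow> real" where
  "frobenius_norm A = sqrt (rtrace (A ** ctranspose A))"

definition outer_H :: "complex^'n \<Rightarrow> complex^'n^'n" where  \<comment> \<open>\<open>x x\<^sup>H\<close>\<close>
  "outer_H x = (\<chi> i j. x $ i * cnj (x $ j))"

definition outer_T :: "complex^'n \<Rightarrow> complex^'n^'n" where  \<comment> \<open>\<open>x x\<^sup>T\<close>\<close>
  "outer_T x = (\<chi> i j. x $ i * x $ j)"

lemma hermitian_nth:
  assumes "hermitian A"
  shows "cnj (A $ i $ j) = A $ j $ i"
proof -
  have "ctranspose A $ j $ i = A $ j $ i"
    using assms unfolding hermitian_def by (rule arg_cong[where f = "\<lambda>B. B $ j $ i"])
  then show ?thesis
    unfolding ctranspose_def by simp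
qed

lemma hermitian_trace:
  assumes "hermitian A"
  shows "trace A = complex_of_real (rtrace A)"
proof -
  have "cnj (trace A) = trace A"
    unfolding trace_def cnj_sum using hermitian_nth[OF assms] by (intro sum.cong) auto
  then show ?thesis
    by (metis Reals_cnj_iff of_real_Re rtrace_def)
qed

lemma hermitian_trace_square:
  assumes "hermitian A"
  shows "trace (A ** A) = complex_of_real (rtrace (A ** A))"
proof (rule hermitian_trace)
  have "cnj ((A ** A) $ j $ i) = (A ** A) $ i $ j" for i j
    unfolding matrix_matrix_mult_def vec_lambda_beta cnj_sum complex_cnj_mult
      hermitian_nth[OF assms]
    by (rule sum.cong) (rule refl, rule mult.commute)
  then show "hermitian (A ** A)"
    by (simp only: hermitian_def ctranspose_def vec_eq_iff vec_lambda_beta) blast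
qed

section \<open>Circularly-symmetric complex Gaussian laws\<close>

text \<open>One-dimensional normal laws include the degenerate ones (point masses), so that singular
  covariance matrices are covered.\<close>

definition real_normal_law :: "real measure \<Rightarrow> bool" where
  "real_normal_law L \<longleftrightarrow>
     (\<exists>\<mu> \<sigma>. 0 < \<sigma> \<and> L = density lborel (\<lambda>x. ennreal (normal_density \<mu> \<sigma> x))) \<or>
     (\<exists>\<mu>. L = return borel \<mu>)"

text \<open>On \<open>complex^'p\<close> the inner product \<open>a \<bullet> x\<close> is the real one, i.e. the real part of
  \<open>a\<^sup>H x\<close>; hence all real-linear functionals of the real and imaginary parts are covered.\<close>

definition gaussian_law :: "'a::euclidean_space measure \<Rightarrow> bool" where
  "gaussian_law N \<longleftrightarrow> prob_space N \<and> sets N = sets borel \<and>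
     (\<forall>a. real_normal_law (distr N borel (\<lambda>x. a \<bullet> x)))"

definition circular_complex_gaussian :: "(complex^'p) measure \<Rightarrow> complex^'p^'p \<Rightarrow> bool" where
  "circular_complex_gaussian N S \<longleftrightarrow> gaussian_law N \<and>
     has_bochner_integral N (\<lambda>x. x) 0 \<and>
     has_bochner_integral N outer_H S \<and>
     has_bochner_integral N outer_T 0"

section \<open>Ledoit-Wolf shrinkage\<close>

definition sample_cov :: "nat \<Rightarrow> (nat \<Rightarrow> complex^'p) \<Rightarrow> complex^'p^'p" where
  "sample_cov K x = (1 / real K) *\<^sub>R (\<Sum>k<K. outer_H (x k))"

definition LW_numerator :: "nat \<Rightarrow> (nat \<Rightarrow> complex^'p) \<Rightarrow> real" where
  "LW_numerator K x = (\<Sum>k<K. (frobenius_norm (outer_H (x k) - sample_cov K x))\<^sup>2)"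

definition LW_bracket :: "complex^'p^'p \<Rightarrow> real" where
  "LW_bracket A = rtrace (A ** A) - (rtrace A)\<^sup>2 / real CARD('p)"

definition rho_LW :: "nat \<Rightarrow> (nat \<Rightarrow> complex^'p) \<Rightarrow> real" where
  "rho_LW K x = LW_numerator K x / ((real K)\<^sup>2 * LW_bracket (sample_cov K x))"

text \<open>Conditional expectation given the \<open>\<sigma>\<close>-algebra generated by a random variable \<open>Y\<close>.
  For nonnegative \<open>f\<close>, \<^const>\<open>real_cond_exp\<close> is built from the conditional expectation of
  nonnegative functions and needs no integrability of \<open>f\<close>.\<close>

definition cond_exp_given ::
    "'a measure \<Rightarrow> ('a \<Rightarrow> 'b::topological_space) \<Rightarrow> ('a \<Rightarrow> real) \<Rightarrow> 'a \<Rightarrow> real" where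
  "cond_exp_given M Y f = real_cond_exp M (vimage_algebra (space M) Y borel) f"

end

theory Submission
  imports Defs
begin

text \<open>The joint law of the snapshots is invariant under replacing two of them, \<open>x\<close> and \<open>y\<close>, by
  \<open>(x \<plusminus> c y) / \<surd>2\<close> with \<open>|c| = 1\<close>, and this replacement does not change the sample covariance.
  Averaging \<open>|x|\<^sup>4 + |y|\<^sup>4\<close> over \<open>c = 1\<close> and \<open>c = \<i>\<close> expresses, conditionally on the sample
  covariance, the fourth powers of the norms through the terms
  \<open>|x|\<^sup>2 |y|\<^sup>2 + |x\<^sup>H y|\<^sup>2\<close>, whose sum over all pairs is a function of the sample covariance.
  Invariance of the law follows by comparing characteristic functions.
  The weight \<open>1 / (1 + tr\<^sup>2)\<close>, itself a function of the sample covariance, makes all integrands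
  bounded, so that no moment estimates are needed.\<close>

section \<open>Uniqueness of characteristic functions on Euclidean spaces\<close>

text \<open>Since \<open>S\<close> may be singular, the snapshots need not have a density, and the
  conditional law of the snapshots given the sample covariance is not computed. Symmetry replaces
  it: with the snapshots as columns of a matrix \<open>X\<close>, \<open>K\<close> times the sample
  covariance is \<open>X X^H\<close>, which is unchanged under \<open>X -> X U\<close> for unitary
  \<open>U\<close>, and circularity makes the law of \<open>X\<close> invariant as well. Only
  mixings of two columns by 2 x 2 unitaries are taken from this group. A second obstacle is that
  \<open>rho_LW\<close> divides by a bracket that may be arbitrarily small; it is therefore treated
  as a nonnegative function. The conditional expectation of a damped numerator is identified first,
  and the remaining factor, a function of the sample covariance, is multiplied back in
  afterwards.\<close>

lemma finite_measure_char_unique: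
  fixes M1 M2 :: "real measure"
  assumes "finite_measure M1" "finite_measure M2"
    and sets: "sets M1 = sets borel" "sets M2 = sets borel"
    and char_eq: "\<And>t. char M1 t = char M2 t"
  shows "M1 = M2"
proof -
  interpret M1: finite_measure M1 by fact
  interpret M2: finite_measure M2 by fact
  have spaces: "space M1 = UNIV" "space M2 = UNIV"
    using sets[THEN sets_eq_imp_space_eq] by auto
  define m where "m = measure M1 UNIV"
  \<comment> \<open>At 0 the characteristic function is the total mass, so the hypothesis forces
    equal masses and one normalising constant serves both measures.\<close>
  have m2: "measure M2 UNIV = m"
    using char_eq[of 0] by (simp add: char_def m_def spaces scaleR_conv_of_real)
  show ?thesis
  proof (cases "m = 0")
    case True
    show ?thesis
    proof (rule measure_eqI)
      fix A
      have "measure M1 A \<le> m" "measure M2 A \<le> m"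
        using M1.bounded_measure[of A] M2.bounded_measure[of A] m2
        by (simp_all add: m_def spaces)
      then show "emeasure M1 A = emeasure M2 A"
        using True by (simp add: M1.emeasure_eq_measure M2.emeasure_eq_measure measure_le_0_iff)
    qed (simp add: sets)
  next
    case False
    then have m: "m > 0"
      by (simp add: m_def order_less_le)
    \<comment> \<open>Levy's uniqueness theorem speaks of probability measures, so both measures are
      rescaled to mass 1; hence the separate case of the zero measure.\<close>
    define N where "N = (\<lambda>M :: real measure. density M (\<lambda>_. ennreal (1 / m)))"
    have real_distr: "real_distribution (N M)"
      if "finite_measure M" "sets M = sets borel" "measure M UNIV = m" for M
    proof -
      interpret finite_measure M by fact
      have [simp]: "space M = UNIV"
        using sets_eq_imp_space_eq[OF that(2)] by simp
      have "emeasure (N M) (space (N M)) = 1"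
        using m that(3) unfolding N_def
        by (subst emeasure_density)
          (auto simp: emeasure_eq_measure ennreal_mult'[symmetric] that(2) simp flip: ennreal_1)
      then show ?thesis
        by (intro real_distribution.intro prob_spaceI real_distribution_axioms.intro)
          (auto simp: N_def that)
    qed
    have char_N: "char (N M) t = complex_of_real (1 / m) * char M t" if "sets M = sets borel" for M t
      unfolding char_def N_def using m that
      by (subst integral_density)
        (auto simp: scaleR_conv_of_real measurable_cong_sets[OF that refl]
          simp del: of_real_divide of_real_1 of_real_mult)
    have "N M1 = N M2"
      using real_distr[OF assms(1) sets(1)] real_distr[OF assms(2) sets(2)] m2
      by (intro Levy_uniqueness) (auto simp: m_def char_N[OF sets(1)] char_N[OF sets(2)] char_eq)
    then have eq: "emeasure (N M1) A = emeasure (N M2) A" for A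
      by simp
    show ?thesis
    proof (rule measure_eqI)
      fix A assume A: "A \<in> sets M1"
      then have "ennreal (1 / m) * emeasure M1 A = ennreal (1 / m) * emeasure M2 A"
        using eq[of A] sets by (simp add: N_def emeasure_density nn_integral_cmult_indicator)
      then show "emeasure M1 A = emeasure M2 A"
        using m by (simp add: M1.emeasure_eq_measure M2.emeasure_eq_measure ennreal_mult'[symmetric])
    qed (simp add: sets)
  qed
qed

text \<open>The weighted measures with density \<open>w\<close> let the one-dimensional uniqueness theorem act on a
  single coordinate while the remaining coordinates are kept in \<open>w\<close>.\<close>

lemma weighted_marginal_unique:
  fixes \<mu> \<nu> :: "'a measure" and w f :: "'a \<Rightarrow> real"
  assumes prob: "prob_space \<mu>" "prob_space \<nu>" and sets: "sets \<mu> = sets L" "sets \<nu> = sets L"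
    and w [measurable]: "w \<in> borel_measurable L" and bound: "\<And>x. 0 \<le> w x" "\<And>x. w x \<le> C"
    and f [measurable]: "f \<in> borel_measurable L"
    and eq: "\<And>s. (CLINT x|\<mu>. w x * iexp (s * f x)) = (CLINT x|\<nu>. w x * iexp (s * f x))"
    and A [measurable]: "A \<in> sets borel"
  shows "(LINT x|\<mu>. w x * indicator A (f x)) = (LINT x|\<nu>. w x * indicator A (f x))"
proof -
  \<comment> \<open>The law of \<open>f\<close> under the measure with density \<open>w\<close>: its
    characteristic function is the weighted integral in the hypothesis, its mass on \<open>A\<close>
    the one in the conclusion.\<close>
  define P where "P M = distr (density M (\<lambda>x. ennreal (w x))) borel f" for M
  have meas: "w \<in> borel_measurable M" "f \<in> borel_measurable M" if "sets M = sets L" for M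
    using w f by (simp_all add: measurable_cong_sets[OF that refl])
  have fin: "finite_measure (P M)" if "prob_space M" "sets M = sets L" for M
  proof -
    interpret prob_space M by fact
    note [measurable] = meas[OF that(2)]
    have "emeasure (density M (\<lambda>x. ennreal (w x))) (space M) = (\<integral>\<^sup>+x. ennreal (w x) \<partial>M)"
      by (subst emeasure_density) (auto intro!: nn_integral_cong)
    also have "\<dots> \<le> (\<integral>\<^sup>+x. ennreal C \<partial>M)"
      using bound by (intro nn_integral_mono ennreal_leI)
    also have "\<dots> < \<infinity>"
      by (simp add: emeasure_space_1)
    finally have "finite_measure (density M (\<lambda>x. ennreal (w x)))"
      by (intro finite_measureI) (simp add: top.not_eq_extremum)
    then show ?thesis
      unfolding P_def by (rule finite_measure.finite_measure_distr) measurable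
  qed
  have char_P: "char (P M) s = (CLINT x|M. w x * iexp (s * f x))" if "sets M = sets L" for M s
  proof -
    note [measurable] = meas[OF that]
    show ?thesis
      unfolding char_def P_def
      by (subst integral_distr, measurable, subst integral_density)
        (auto simp: bound scaleR_conv_of_real)
  qed
  have meas_P: "(LINT x|M. w x * indicator A (f x)) = (LINT y|P M. indicator A y)"
    if "sets M = sets L" for M
  proof -
    note [measurable] = meas[OF that]
    show ?thesis
      unfolding P_def
      by (subst integral_distr, measurable, subst integral_density) (auto simp: bound)
  qed
  have "P \<mu> = P \<nu>"
    by (rule finite_measure_char_unique)
      (auto intro: fin prob sets simp: char_P sets eq[simplified], auto simp: P_def)
  then show ?thesis
    by (simp only: meas_P[OF sets(1)] meas_P[OF sets(2)])
qed

text \<open>A density must be nonnegative, so the oscillating factor of the remaining coordinates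
  can enter a weight only as \<open>1 + cos\<close>. The identity brings such a weighted exponential
  back to pure exponentials, to which an induction hypothesis on characteristic functions
  applies.\<close>

lemma iexp_times_cos:
  "complex_of_real (1 + cos (x + \<theta>)) * iexp y
    = iexp y + (iexp \<theta> * iexp (y + x) + iexp (- \<theta>) * iexp (y - x)) / 2"
  by (simp add: exp_add exp_diff exp_minus cos_of_real[symmetric] cos_exp_eq ring_distribs
      field_simps del: cos_of_real)

lemma (in prob_space) integrable_bounded_iexp:
  fixes g h :: "'a \<Rightarrow> real"
  assumes [measurable]: "g \<in> borel_measurable M" "h \<in> borel_measurable M"
    and "\<And>x. \<bar>g x\<bar> \<le> C"
  shows "complex_integrable M (\<lambda>x. g x * iexp (h x))"
  by (rule integrable_const_bound[of _ C]) (use assms in \<open>auto simp: norm_mult\<close>)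

text \<open>Coordinates are converted one at a time from an exponential factor to the indicator of a
  Borel set. Once all of \<open>Basis\<close> is converted, the two measures can be compared on
  boxes.\<close>

theorem euclidean_char_unique:
  fixes \<mu> \<nu> :: "'a::euclidean_space measure"
  assumes prob: "prob_space \<mu>" "prob_space \<nu>"
    and sets: "sets \<mu> = sets borel" "sets \<nu> = sets borel"
    and char_eq: "\<And>t. (CLINT x|\<mu>. iexp (t \<bullet> x)) = (CLINT x|\<nu>. iexp (t \<bullet> x))"
  shows "\<mu> = \<nu>"
proof -
  interpret \<mu>: prob_space \<mu> by fact
  interpret \<nu>: prob_space \<nu> by fact
  note [measurable_cong] = sets
  define G :: "'a set \<Rightarrow> ('a \<Rightarrow> real set) \<Rightarrow> 'a \<Rightarrow> real"
    where "G F A x = (\<Prod>b\<in>F. indicator (A b) (x \<bullet> b))" for F A x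
  have G_bound: "0 \<le> G F A x" "G F A x \<le> 1" for F A x
    by (auto simp: G_def intro!: prod_nonneg prod_le_1)
  have G_meas: "G F A \<in> borel_measurable borel" if "\<And>b. b \<in> F \<Longrightarrow> A b \<in> sets borel" for F A
  proof -
    have "(\<lambda>x. indicator (A b) (x \<bullet> b) :: real) \<in> borel_measurable borel" if "b \<in> F" for b
    proof -
      have [measurable]: "A b \<in> sets borel"
        using that \<open>\<And>b. b \<in> F \<Longrightarrow> A b \<in> sets borel\<close> by blast
      show ?thesis by measurable
    qed
    then show ?thesis
      unfolding G_def[abs_def] by (rule borel_measurable_prod)
  qed
  have main: "(CLINT x|\<mu>. G F A x * iexp (t \<bullet> x)) = (CLINT x|\<nu>. G F A x * iexp (t \<bullet> x))"
    if "finite F" "\<And>b. b \<in> F \<Longrightarrow> A b \<in> sets borel" for F A t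
    using that
  \<comment> \<open>\<open>t\<close> varies because inserting \<open>b\<close> uses the hypothesis
    at the frequencies \<open>s *\<^sub>R b\<close> and \<open>s *\<^sub>R b\<close> plus or minus
    \<open>t\<close>.\<close>
  proof (induction F arbitrary: t)
    case empty
    show ?case by (simp add: G_def char_eq)
  next
    case (insert b F)
    have [measurable]: "G F A \<in> borel_measurable borel" "A b \<in> sets borel"
      using insert.prems by (auto intro!: G_meas)
    define H where "H x = G F A x * indicator (A b) (x \<bullet> b)" for x
    have [measurable]: "H \<in> borel_measurable borel"
      unfolding H_def[abs_def] by measurable
    have H_bound: "\<bar>H x\<bar> \<le> 1" for x
      using G_bound[of F A x] by (auto simp: H_def indicator_def)
    have H_cos1: "(LINT x|\<mu>. H x * (1 + cos (t \<bullet> x + \<theta>))) = (LINT x|\<nu>. H x * (1 + cos (t \<bullet> x + \<theta>)))"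
      for t \<theta>
    proof -
      define w where "w x = G F A x * (1 + cos (t \<bullet> x + \<theta>))" for x
      have w_iexp: "w x * iexp (s * (x \<bullet> b)) = G F A x * iexp ((s *\<^sub>R b) \<bullet> x)
          + (iexp \<theta> / 2 * (G F A x * iexp ((s *\<^sub>R b + t) \<bullet> x))
            + iexp (- \<theta>) / 2 * (G F A x * iexp ((s *\<^sub>R b - t) \<bullet> x)))" for s x
        using iexp_times_cos[of "t \<bullet> x" \<theta> "s * (x \<bullet> b)"]
        unfolding w_def of_real_mult mult.assoc
        by (simp add: inner_commute[of b] inner_add_left inner_diff_left ring_distribs add_divide_distrib
              mult.left_commute[of "complex_of_real (G F A x)"])
      have int: "complex_integrable \<mu> (\<lambda>x. G F A x * iexp (u \<bullet> x))"
        "complex_integrable \<nu> (\<lambda>x. G F A x * iexp (u \<bullet> x))" for u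
        using G_bound[of F A]
        by (auto intro!: \<mu>.integrable_bounded_iexp[of _ _ 1] \<nu>.integrable_bounded_iexp[of _ _ 1])
      have "(LINT x|\<mu>. w x * indicator (A b) (x \<bullet> b)) = (LINT x|\<nu>. w x * indicator (A b) (x \<bullet> b))"
      proof (rule weighted_marginal_unique[OF prob sets, where C = 2])
        show "w \<in> borel_measurable borel"
          unfolding w_def[abs_def] by measurable
        show "0 \<le> w x" for x
          unfolding w_def using G_bound[of F A x] cos_ge_minus_one[of "t \<bullet> x + \<theta>"]
          by (intro mult_nonneg_nonneg) linarith+
        show "w x \<le> 2" for x
        proof -
          have "0 \<le> 1 + cos (t \<bullet> x + \<theta>)" "1 + cos (t \<bullet> x + \<theta>) \<le> 2"
            using cos_ge_minus_one[of "t \<bullet> x + \<theta>"] cos_le_one[of "t \<bullet> x + \<theta>"] by linarith+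
          then have "G F A x * (1 + cos (t \<bullet> x + \<theta>)) \<le> 1 * 2"
            by (intro mult_mono G_bound) auto
          then show ?thesis
            by (simp add: w_def)
        qed
        have lin: "(CLINT x|M. f x + (c * g x + d * h x))
            = (CLINT x|M. f x) + (c * (CLINT x|M. g x) + d * (CLINT x|M. h x))"
          if "complex_integrable M f" "complex_integrable M g" "complex_integrable M h"
          for M :: "'a measure" and f g h c d
          using that by simp
        show "(CLINT x|\<mu>. w x * iexp (s * (x \<bullet> b))) = (CLINT x|\<nu>. w x * iexp (s * (x \<bullet> b)))" for s
          unfolding w_iexp lin[OF int(1) int(1) int(1)] lin[OF int(2) int(2) int(2)]
          using insert.prems by (simp only: insert.IH insertI2)
      qed measurable
      then show ?thesis
        by (simp add: w_def H_def mult_ac)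
    qed
    have int_H: "integrable \<mu> (\<lambda>x. H x * k x)" "integrable \<nu> (\<lambda>x. H x * k x)"
      if [measurable]: "k \<in> borel_measurable borel" and "\<And>x. \<bar>k x\<bar> \<le> 1" for k
    proof -
      have "norm (H x * k x) \<le> 1" for x
        using H_bound that(2) by (simp add: abs_mult mult_le_one)
      then show "integrable \<mu> (\<lambda>x. H x * k x)" "integrable \<nu> (\<lambda>x. H x * k x)"
        by (auto intro!: \<mu>.integrable_const_bound[of _ 1] \<nu>.integrable_const_bound[of _ 1])
    qed
    have H_cos: "(LINT x|\<mu>. H x * cos (t \<bullet> x + \<theta>)) = (LINT x|\<nu>. H x * cos (t \<bullet> x + \<theta>))" for t \<theta>
    proof -
      \<comment> \<open>With frequency and phase 0 the weight \<open>1 + cos\<close> is the constant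
        2; this isolates the constant term, which is then subtracted.\<close>
      have "(LINT x|\<mu>. H x * 1) = (LINT x|\<nu>. H x * 1)"
        using H_cos1[of 0 0] by simp
      then show ?thesis
        using H_cos1[of t \<theta>] int_H[of "\<lambda>_. 1"] int_H[of "\<lambda>x. cos (t \<bullet> x + \<theta>)"]
        by (simp add: ring_distribs)
    qed
    \<comment> \<open>The phases \<open>0\<close> and \<open>- pi / 2\<close> turn the cosine into
      the real and the imaginary part of the exponential.\<close>
    have H_iexp: "H x * iexp (t \<bullet> x) = complex_of_real (H x * cos (t \<bullet> x + 0))
        + \<i> * complex_of_real (H x * cos (t \<bullet> x + - pi / 2))" for x
      using cos_sin_eq[of "t \<bullet> x"] sin_cos_eq[of "t \<bullet> x"] cos_minus[of "pi / 2 - t \<bullet> x"]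
      by (simp add: exp_Euler sin_of_real cos_of_real ring_distribs)
    have "G (insert b F) A x = H x" for x
      using insert.hyps by (simp add: G_def H_def mult.commute)
    then have eq: "G (insert b F) A = H"
      by auto
    show ?case
      unfolding eq H_iexp
      using int_H[of "\<lambda>x. cos (t \<bullet> x + 0)"] int_H[of "\<lambda>x. cos (t \<bullet> x + - pi / 2)"]
        H_cos[of t 0] H_cos[of t "- pi / 2"]
      by (subst (1 2) Bochner_Integration.integral_add)
        (auto simp del: of_real_mult intro!: integrable_mult_right)
  qed
  \<comment> \<open>At frequency 0 only the indicators remain. Over open intervals their product is
    the indicator of a box, and boxes form an intersection-stable generator of the Borel
    sets.\<close>
  have G_box: "G Basis (\<lambda>i. {l \<bullet> i<..<u \<bullet> i}) x = indicator (box l u) x" for l u x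
    by (auto simp: G_def indicator_def mem_box)
  have box_eq: "emeasure \<mu> (box l u) = emeasure \<nu> (box l u)" for l u
    using main[of Basis "\<lambda>i. {l \<bullet> i<..<u \<bullet> i}" 0]
    by (simp add: G_box \<mu>.emeasure_eq_measure \<nu>.emeasure_eq_measure
        sets_eq_imp_space_eq[OF sets(1)] sets_eq_imp_space_eq[OF sets(2)])
  let ?E = "range (\<lambda>(l, u). box l u :: 'a set)"
  show ?thesis
  proof (rule measure_eqI_generator_eq)
    show "Int_stable ?E" "?E \<subseteq> Pow UNIV"
      by (auto simp: Int_stable_def box_Int_box)
    show "sets \<mu> = sigma_sets UNIV ?E" "sets \<nu> = sigma_sets UNIV ?E"
      by (simp_all add: borel_eq_box sets)
    let ?A = "\<lambda>n::nat. box (- (real n *\<^sub>R One)) (real n *\<^sub>R One) :: 'a set"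
    show "range ?A \<subseteq> ?E" "(\<Union>i. ?A i) = UNIV"
      unfolding UN_box_eq_UNIV by auto
    show "emeasure \<mu> (?A i) \<noteq> \<infinity>" for i
      by (simp add: \<mu>.emeasure_eq_measure)
    show "emeasure \<mu> X = emeasure \<nu> X" if "X \<in> ?E" for X
      using that box_eq by auto
  qed
qed

section \<open>Rotation invariance of the circular complex Gaussian law\<close>

text \<open>A point mass with mean 0 sits at 0 and has second moment 0, so one formula covers the
  degenerate and the nondegenerate laws.\<close>

lemma real_normal_law_centered:
  assumes "real_normal_law L" and mean: "(LINT x|L. x) = 0"
  shows "integrable L (\<lambda>x. x\<^sup>2)" "char L t = exp (- ((LINT x|L. x\<^sup>2) * t\<^sup>2 / 2))"
proof -
  have "integrable L (\<lambda>x. x\<^sup>2) \<and> char L t = exp (- ((LINT x|L. x\<^sup>2) * t\<^sup>2 / 2))"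
    using assms(1) unfolding real_normal_law_def
  proof (elim disjE exE conjE)
    fix \<mu> assume L: "L = return borel \<mu>"
    then have "\<mu> = 0"
      using mean by (simp add: integral_return)
    then show ?thesis
      by (simp add: L char_def integral_return integrable_iff_bounded nn_integral_return)
  next
    fix \<mu> \<sigma> :: real
    assume \<sigma>: "0 < \<sigma>" and L: "L = density lborel (\<lambda>x. ennreal (normal_density \<mu> \<sigma> x))"
    have "(LINT x|L. x) = (LINT x|lborel. normal_density \<mu> \<sigma> x * x)"
      unfolding L by (subst integral_density) auto
    then have \<mu>: "\<mu> = 0"
      using mean integral_normal_moment_nz_1[OF \<sigma>, of \<mu>] by simp
    have moment: "has_bochner_integral lborel (\<lambda>x. normal_density 0 \<sigma> x * x\<^sup>2) (\<sigma>\<^sup>2)"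
      using normal_moment_even[OF \<sigma>, of 0 1] by (simp add: fact_numeral power2_eq_square mult_ac)
    have int: "integrable L (\<lambda>x. x\<^sup>2)"
      using moment unfolding L \<mu> by (subst integrable_density) (auto simp: has_bochner_integral_iff)
    have var: "(LINT x|L. x\<^sup>2) = \<sigma>\<^sup>2"
      using moment unfolding L \<mu> by (subst integral_density) (auto simp: has_bochner_integral_iff)
    interpret std: prob_space "density lborel std_normal_density"
      by (rule prob_space_normal_density) simp
    \<comment> \<open>The law is written as the standard normal law scaled by
      \<open>\<sigma>\<close>, which reduces its characteristic function to the standard
      one.\<close>
    have "distributed (density lborel std_normal_density) lborel (\<lambda>x. x) std_normal_density"
      by (auto simp: distributed_def intro!: measure_eqI simp: emeasure_distr)
    from std.normal_density_affine[OF this _ , of \<sigma> 0] \<sigma>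
    have "L = distr (density lborel std_normal_density) lborel (\<lambda>x. \<sigma> * x)"
      by (simp add: distributed_def L \<mu>)
    then have "char L t = char (density lborel std_normal_density) (\<sigma> * t)"
      unfolding char_def by (simp, subst integral_distr) (auto simp: mult_ac)
    then show ?thesis
      using int var by (simp add: char_std_normal_distribution power_mult_distrib exp_of_real mult_ac)
  qed
  then show "integrable L (\<lambda>x. x\<^sup>2)" "char L t = exp (- ((LINT x|L. x\<^sup>2) * t\<^sup>2 / 2))"
    by auto
qed

text \<open>The value at \<open>a\<close> is the characteristic function of the law of
  \<open>a \<bullet> x\<close> at 1. Hence the real quadratic form of second moments carries all
  information about the law.\<close>

lemma gaussian_law_centered:
  fixes N :: "'a::euclidean_space measure"
  assumes "gaussian_law N" and mean: "has_bochner_integral N (\<lambda>x. x) 0"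
  shows "integrable N (\<lambda>x. (a \<bullet> x)\<^sup>2)"
    and "(CLINT x|N. iexp (a \<bullet> x)) = exp (- ((LINT x|N. (a \<bullet> x)\<^sup>2) / 2))"
proof -
  define L where "L = distr N borel (\<lambda>x. a \<bullet> x)"
  have law: "real_normal_law L" and [measurable_cong]: "sets N = sets borel"
    using assms by (auto simp: gaussian_law_def L_def)
  have "(LINT x|L. x) = (LINT x|N. a \<bullet> x)"
    unfolding L_def by (subst integral_distr) auto
  also have "\<dots> = 0"
    using mean by (simp add: has_bochner_integral_iff)
  finally have 0: "(LINT x|L. x) = 0" .
  note L = real_normal_law_centered[OF law 0]
  have "integrable L (\<lambda>x. x\<^sup>2) \<longleftrightarrow> integrable N (\<lambda>x. (a \<bullet> x)\<^sup>2)"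
    unfolding L_def by (subst integrable_distr_eq) auto
  then show "integrable N (\<lambda>x. (a \<bullet> x)\<^sup>2)"
    using L(1) by simp
  have "(LINT x|L. x\<^sup>2) = (LINT x|N. (a \<bullet> x)\<^sup>2)"
    unfolding L_def by (subst integral_distr) auto
  moreover have "char L 1 = (CLINT x|N. iexp (a \<bullet> x))"
    unfolding L_def char_def by (subst integral_distr) auto
  ultimately show "(CLINT x|N. iexp (a \<bullet> x)) = exp (- ((LINT x|N. (a \<bullet> x)\<^sup>2) / 2))"
    using L(2)[of 1] by simp
qed

section \<open>Complex scalars in the real inner product, and circularity\<close>

lemma inner_vec_complex: "a \<bullet> x = Re (\<Sum>l\<in>UNIV. cnj (a $ l) * x $ l)"
  for a x :: "complex^'p"
  by (simp add: inner_vec_def inner_complex_def)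

lemma inner_scalar_mult_right: "a \<bullet> (c *s x) = (cnj c *s a) \<bullet> x"
  for a x :: "complex^'p"
  by (simp add: inner_vec_complex mult_ac)

lemma linear_scalar_mult: "linear (\<lambda>x :: complex^'p. c *s x)"
  by (rule linearI) (simp_all add: vec_eq_iff ring_distribs)

lemma borel_measurable_scalar_mult [measurable]:
  "(\<lambda>x :: complex^'p. c *s x) \<in> borel_measurable borel"
  by (intro borel_measurable_continuous_onI linear_continuous_on)
    (simp add: linear_scalar_mult linear_linear)

text \<open>The square of \<open>a^H x\<close> is linear in \<open>x x^T\<close>, so a vanishing
  pseudo-covariance makes its mean vanish.\<close>

lemma sum_cnj_mult_square:
  "(\<Sum>l\<in>UNIV. cnj (a $ l) * x $ l)\<^sup>2
    = (\<Sum>l\<in>UNIV. \<Sum>m\<in>UNIV. cnj (a $ l) * cnj (a $ m) * outer_T x $ l $ m)"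
  by (simp add: power2_eq_square sum_product outer_T_def mult_ac)

text \<open>With \<open>z\<close> equal to \<open>a^H x\<close>, the vanishing mean of
  \<open>z\<^sup>2\<close> says that the real and imaginary parts of \<open>z\<close> have the same
  second moment; multiplying \<open>a\<close> by the conjugate of \<open>\<i>\<close> replaces the
  real part by minus the imaginary part. This is where circularity enters.\<close>

lemma circular_variance_invariant:
  fixes N :: "(complex^'p) measure"
  assumes circ: "circular_complex_gaussian N S" and c: "c = 1 \<or> c = \<i>"
  shows "(LINT x|N. ((cnj c *s a) \<bullet> x)\<^sup>2) = (LINT x|N. (a \<bullet> x)\<^sup>2)"
proof (cases "c = 1")
  case False
  then have [simp]: "c = \<i>"
    using c by simp
  define z where "z x = (\<Sum>l\<in>UNIV. cnj (a $ l) * x $ l)" for x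
  have int: "integrable N (\<lambda>x. (b \<bullet> x)\<^sup>2)" for b
    using circ by (auto simp: circular_complex_gaussian_def intro: gaussian_law_centered)
  have "has_bochner_integral N outer_T 0"
    using circ by (simp add: circular_complex_gaussian_def)
  then have "has_bochner_integral N (\<lambda>x. outer_T x $ l $ m) ((0 :: complex^'p^'p) $ l $ m)" for l m
    by (intro has_bochner_integral_bounded_linear[OF bounded_linear_vec_nth]) simp
  then have "has_bochner_integral N
      (\<lambda>x. \<Sum>l\<in>UNIV. \<Sum>m\<in>UNIV. cnj (a $ l) * cnj (a $ m) * outer_T x $ l $ m)
      (\<Sum>l\<in>UNIV. \<Sum>m\<in>UNIV. cnj (a $ l) * cnj (a $ m) * (0 :: complex^'p^'p) $ l $ m)"
    by (intro has_bochner_integral_sum has_bochner_integral_mult_right)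
  then have "has_bochner_integral N (\<lambda>x. (z x)\<^sup>2) 0"
    by (simp add: sum_cnj_mult_square z_def)
  then have "has_bochner_integral N (\<lambda>x. Re ((z x)\<^sup>2)) (Re 0)"
    by (intro has_bochner_integral_bounded_linear[OF bounded_linear_Re])
  moreover have "a \<bullet> x = Re (z x)" "(cnj c *s a) \<bullet> x = - Im (z x)" for x
    unfolding inner_vec_complex z_def by (simp_all add: mult.assoc flip: sum_negf)
  then have "Re ((z x)\<^sup>2) = (a \<bullet> x)\<^sup>2 - ((cnj c *s a) \<bullet> x)\<^sup>2" for x
    by (simp only: Re_power2 power2_minus)
  ultimately have "(LINT x|N. (a \<bullet> x)\<^sup>2 - ((cnj c *s a) \<bullet> x)\<^sup>2) = 0"
    by (simp add: has_bochner_integral_iff)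
  then show ?thesis
    using int[of a] int[of "cnj c *s a"] by simp
qed simp

section \<open>Unitary mixing of two independent vectors\<close>

lemma distrib_regroup: "r * (a + b) + r * (c - d) = r * (a + c) + r * (b - d)"
  for r a b c d :: real
  by (simp add: algebra_simps)

text \<open>The matrix with rows \<open>(1, c) / \<surd>2\<close> and
  \<open>(1, - c) / \<surd>2\<close>, unitary for \<open>|c| = 1\<close>, acting on a pair of
  vectors.\<close>

definition unitary_mix :: "complex \<Rightarrow> (complex^'p) \<times> (complex^'p) \<Rightarrow> (complex^'p) \<times> (complex^'p)"
  where "unitary_mix c z = ((1 / sqrt 2) *\<^sub>R (fst z + c *s snd z), (1 / sqrt 2) *\<^sub>R (fst z - c *s snd z))"

lemma borel_measurable_unitary_mix [measurable]:
  "unitary_mix c \<in> borel \<Otimes>\<^sub>M borel \<rightarrow>\<^sub>M borel \<Otimes>\<^sub>M borel"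
  unfolding unitary_mix_def[abs_def] by measurable

text \<open>The characteristic function of the product law depends on \<open>t\<close> only through
  \<open>q (fst t) + q (snd t)\<close>. The adjoint of the mix preserves this sum: the sum and
  difference by the parallelogram law, the phase by circularity.\<close>

lemma distr_unitary_mix:
  fixes N :: "(complex^'p) measure"
  assumes circ: "circular_complex_gaussian N S" and c: "c = 1 \<or> c = \<i>"
  shows "distr (N \<Otimes>\<^sub>M N) (N \<Otimes>\<^sub>M N) (unitary_mix c) = N \<Otimes>\<^sub>M N"
proof -
  have gauss: "gaussian_law N" "has_bochner_integral N (\<lambda>x. x) 0"
    using circ by (auto simp: circular_complex_gaussian_def)
  then interpret N: prob_space N
    by (simp add: gaussian_law_def)
  interpret NN: pair_prob_space N N ..
  have sets_N [measurable_cong]: "sets N = sets borel"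
    using gauss by (simp add: gaussian_law_def)
  have sets_NN: "sets (N \<Otimes>\<^sub>M N) = sets (borel \<Otimes>\<^sub>M borel)"
    by (intro sets_pair_measure_cong sets_N)
  define q where "q a = (LINT x|N. (a \<bullet> x)\<^sup>2)" for a
  note int = gaussian_law_centered(1)[OF gauss]
  note char_N = gaussian_law_centered(2)[OF gauss, folded q_def]
  have char_NN: "(CLINT z|N \<Otimes>\<^sub>M N. iexp (t \<bullet> z)) = exp (- ((q (fst t) + q (snd t)) / 2))" for t
  proof -
    have "(CLINT z|N \<Otimes>\<^sub>M N. iexp (t \<bullet> z)) = (CLINT x|N. CLINT y|N. iexp (fst t \<bullet> x) * iexp (snd t \<bullet> y))"
      by (subst NN.integral_fst'[symmetric])
        (auto simp: inner_prod_def exp_add ring_distribs norm_mult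
          intro!: NN.integrable_const_bound[of _ 1] AE_I2)
    also have "\<dots> = exp (- (q (fst t) / 2)) * exp (- (q (snd t) / 2))"
      by (simp add: char_N)
    finally show ?thesis
      by (simp add: add_divide_distrib flip: exp_add)
  qed
  have q_mix: "q ((1 / sqrt 2) *\<^sub>R (a + b)) + q (cnj c *s ((1 / sqrt 2) *\<^sub>R (a - b))) = q a + q b" for a b
  proof -
    have parallelogram: "(((1 / sqrt 2) *\<^sub>R (a + b)) \<bullet> x)\<^sup>2 + (((1 / sqrt 2) *\<^sub>R (a - b)) \<bullet> x)\<^sup>2
        = (a \<bullet> x)\<^sup>2 + (b \<bullet> x)\<^sup>2" for x
      unfolding inner_scaleR_left inner_add_left inner_diff_left power_mult_distrib power2_sum power2_diff
      by (simp add: power_divide field_simps)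
    have "q ((1 / sqrt 2) *\<^sub>R (a + b)) + q ((1 / sqrt 2) *\<^sub>R (a - b))
        = (LINT x|N. (((1 / sqrt 2) *\<^sub>R (a + b)) \<bullet> x)\<^sup>2 + (((1 / sqrt 2) *\<^sub>R (a - b)) \<bullet> x)\<^sup>2)"
      unfolding q_def by (intro Bochner_Integration.integral_add[symmetric] int)
    also have "\<dots> = (LINT x|N. (a \<bullet> x)\<^sup>2 + (b \<bullet> x)\<^sup>2)"
      by (simp only: parallelogram)
    also have "\<dots> = q a + q b"
      unfolding q_def by (intro Bochner_Integration.integral_add int)
    finally show ?thesis
      by (simp add: q_def circular_variance_invariant[OF circ c])
  qed
  show ?thesis
  proof (rule euclidean_char_unique)
    have [measurable]: "unitary_mix c \<in> N \<Otimes>\<^sub>M N \<rightarrow>\<^sub>M N \<Otimes>\<^sub>M N"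
      by measurable
    show "prob_space (distr (N \<Otimes>\<^sub>M N) (N \<Otimes>\<^sub>M N) (unitary_mix c))"
      by (rule NN.prob_space_distr) measurable
    show "prob_space (N \<Otimes>\<^sub>M N)"
      by (rule NN.P.prob_space_axioms)
    show "sets (N \<Otimes>\<^sub>M N) = sets borel" "sets (distr (N \<Otimes>\<^sub>M N) (N \<Otimes>\<^sub>M N) (unitary_mix c)) = sets borel"
      by (simp_all only: sets_distr sets_NN borel_prod)
    fix t :: "(complex^'p) \<times> (complex^'p)"
    have "t \<bullet> unitary_mix c z
        = ((1 / sqrt 2) *\<^sub>R (fst t + snd t), cnj c *s ((1 / sqrt 2) *\<^sub>R (fst t - snd t))) \<bullet> z" for z
      unfolding unitary_mix_def inner_prod_def fst_conv snd_conv inner_scalar_mult_right[symmetric]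
        inner_scaleR_left inner_scaleR_right inner_add_left inner_add_right inner_diff_left inner_diff_right
      by (rule distrib_regroup)
    then have "(CLINT z|N \<Otimes>\<^sub>M N. iexp (t \<bullet> unitary_mix c z)) = exp (- ((q (fst t) + q (snd t)) / 2))"
      by (simp only: char_NN q_mix fst_conv snd_conv)
    moreover have "(\<lambda>z. iexp (t \<bullet> z)) \<in> borel_measurable (N \<Otimes>\<^sub>M N)"
      unfolding measurable_cong_sets[OF sets_NN refl] borel_prod by measurable
    ultimately show "(CLINT z|distr (N \<Otimes>\<^sub>M N) (N \<Otimes>\<^sub>M N) (unitary_mix c). iexp (t \<bullet> z))
        = (CLINT z|N \<Otimes>\<^sub>M N. iexp (t \<bullet> z))"
      by (subst integral_distr) (simp_all only: char_NN, measurable)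
  qed
qed

section \<open>Rank-one matrices and the sample covariance\<close>

text \<open>The inner product is \<open>|x^H y|\<^sup>2\<close>, split into the squares of real and
  imaginary part because these are the cross terms produced by the phases \<open>1\<close> and
  \<open>\<i>\<close>.\<close>

lemma inner_outer_H: "outer_H x \<bullet> outer_H y = (x \<bullet> y)\<^sup>2 + (x \<bullet> (\<i> *s y))\<^sup>2"
proof -
  define z where "z = (\<Sum>l\<in>UNIV. cnj (x $ l) * y $ l)"
  have inner: "x \<bullet> y = Re z" "x \<bullet> (\<i> *s y) = - Im z"
    by (simp_all add: z_def inner_vec_complex mult.left_commute[of _ \<i>] flip: sum_distrib_left)
  have "outer_H x \<bullet> outer_H y
      = Re (\<Sum>l\<in>UNIV. \<Sum>m\<in>UNIV. (cnj (x $ l) * y $ l) * cnj (cnj (x $ m) * y $ m))"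
    unfolding inner_vec_def[of "outer_H x"] inner_vec_complex Re_sum[symmetric]
    by (simp add: outer_H_def mult_ac)
  also have "\<dots> = Re (z * cnj z)"
    by (simp add: z_def sum_product)
  also have "\<dots> = (x \<bullet> y)\<^sup>2 + (x \<bullet> (\<i> *s y))\<^sup>2"
    by (simp add: inner power2_eq_square)
  finally show ?thesis .
qed

lemma norm_outer_H: "norm (outer_H x) = (norm x)\<^sup>2"
proof -
  have "x \<bullet> (\<i> *s x) = 0"
    by (simp add: inner_vec_def inner_complex_def)
  then have "(norm (outer_H x))\<^sup>2 = ((norm x)\<^sup>2)\<^sup>2"
    by (simp add: power2_norm_eq_inner inner_outer_H)
  then show ?thesis
    by (rule power2_eq_imp_eq) simp_all
qed

lemma rtrace_outer_H: "rtrace (outer_H x) = (norm x)\<^sup>2"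
  by (simp add: rtrace_def trace_def outer_H_def power2_norm_eq_inner inner_vec_def inner_complex_def)

text \<open>As an inner product with the identity matrix, the trace is visibly linear and continuous
  and is open to the Cauchy-Schwarz inequality.\<close>

lemma rtrace_eq_inner: "rtrace A = mat 1 \<bullet> A"
  for A :: "complex^'n^'n"
proof -
  have "(mat 1 :: complex^'n^'n) $ i \<bullet> A $ i = Re (A $ i $ i)" for i
    by (simp add: inner_vec_complex mat_def if_distrib[of cnj] if_distrib[of "\<lambda>z. z * _"] cong: if_cong)
  then show ?thesis
    by (simp add: rtrace_def trace_def inner_vec_def[of "mat 1 :: complex^'n^'n"])
qed

lemma norm_mat_1: "(norm (mat 1 :: complex^'n^'n))\<^sup>2 = real CARD('n)"
  unfolding power2_norm_eq_inner rtrace_eq_inner[symmetric]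
  by (simp add: rtrace_def trace_def mat_def)

lemma frobenius_norm_eq_norm: "frobenius_norm A = norm A"
proof -
  have "rtrace (A ** ctranspose A) = A \<bullet> A"
    unfolding inner_vec_def[of A]
    by (simp add: rtrace_def trace_def matrix_matrix_mult_def ctranspose_def inner_vec_def inner_complex_def)
  then show ?thesis
    by (simp add: frobenius_norm_def norm_eq_sqrt_inner)
qed

lemma rtrace_square_hermitian:
  assumes "hermitian A"
  shows "rtrace (A ** A) = (norm A)\<^sup>2"
proof -
  have "rtrace (A ** ctranspose A) = (frobenius_norm A)\<^sup>2"
    unfolding frobenius_norm_eq_norm
    using frobenius_norm_eq_norm[of A] by (metis frobenius_norm_def norm_ge_zero real_sqrt_ge_0_iff real_sqrt_pow2)
  then show ?thesis
    using assms by (simp add: hermitian_def frobenius_norm_eq_norm)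
qed

section \<open>The sample covariance and the Ledoit-Wolf quantities\<close>

lemma hermitian_sample_cov: "hermitian (sample_cov K x)"
  by (simp add: hermitian_def ctranspose_def sample_cov_def outer_H_def vec_eq_iff mult.commute
      scaleR_conv_of_real[where 'a = complex])

lemma rtrace_sample_cov: "rtrace (sample_cov K x) = (\<Sum>k<K. (norm (x k))\<^sup>2) / real K"
  by (simp add: rtrace_eq_inner sample_cov_def inner_sum_right flip: rtrace_outer_H)

text \<open>Each rank-one summand has norm equal to its trace, so the triangle inequality suffices.
  Through this bound the squared trace also dominates the terms in the squared norm.\<close>

lemma norm_sample_cov_le: "norm (sample_cov K x) \<le> rtrace (sample_cov K x)"
proof -
  have "norm (\<Sum>k<K. outer_H (x k)) \<le> (\<Sum>k<K. (norm (x k))\<^sup>2)"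
    by (rule norm_sum[THEN order_trans]) (simp add: norm_outer_H)
  then show ?thesis
    by (simp add: rtrace_sample_cov) (simp add: sample_cov_def divide_right_mono)
qed

text \<open>Cauchy-Schwarz against the identity matrix, whose squared norm is the dimension. It
  makes \<open>rho_LW\<close> nonnegative.\<close>

lemma LW_bracket_nonneg:
  assumes "hermitian A"
  shows "0 \<le> LW_bracket A"
proof -
  have "(rtrace A)\<^sup>2 \<le> (norm (mat 1 :: complex^'a^'a) * norm A)\<^sup>2"
    unfolding rtrace_eq_inner by (rule abs_le_square_iff[THEN iffD1]) (simp add: Cauchy_Schwarz_ineq2)
  then show ?thesis
    by (simp add: LW_bracket_def rtrace_square_hermitian[OF assms] power_mult_distrib norm_mat_1
        field_simps)
qed

lemma LW_numerator_nonneg: "0 \<le> LW_numerator K x"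
  by (simp add: LW_numerator_def sum_nonneg)

text \<open>The usual variance decomposition: the outer products sum to \<open>K\<close> times their
  mean, so the mixed terms combine with the squares of the mean.\<close>

lemma LW_numerator_eq:
  assumes "K \<ge> 1"
  shows "LW_numerator K x = (\<Sum>k<K. (norm (x k))^4) - real K * (norm (sample_cov K x))\<^sup>2"
proof -
  define m where "m = sample_cov K x"
  have sum: "(\<Sum>k<K. outer_H (x k)) = real K *\<^sub>R m"
    using assms by (simp add: m_def sample_cov_def)
  have sq: "(norm (a - m))\<^sup>2 = (norm a)\<^sup>2 - 2 * (a \<bullet> m) + (norm m)\<^sup>2" for a
    by (simp add: power2_norm_eq_inner inner_diff_left inner_diff_right inner_commute)
  have "LW_numerator K x = (\<Sum>k<K. (norm (outer_H (x k)))\<^sup>2 - 2 * (outer_H (x k) \<bullet> m) + (norm m)\<^sup>2)"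
    unfolding LW_numerator_def frobenius_norm_eq_norm m_def[symmetric] sq ..
  also have "\<dots> = (\<Sum>k<K. (norm (x k))^4) - 2 * ((\<Sum>k<K. outer_H (x k)) \<bullet> m) + real K * (norm m)\<^sup>2"
    by (simp add: sum.distrib sum_subtractf inner_sum_left sum_distrib_left norm_outer_H
        flip: power_mult)
  also have "\<dots> = (\<Sum>k<K. (norm (x k))^4) - real K * (norm m)\<^sup>2"
    by (simp add: sum power2_norm_eq_inner)
  finally show ?thesis
    by (simp add: m_def)
qed

text \<open>Both double sums factor, one into the square of the sum of the traces, the other into
  the squared norm of the sum of the outer products.\<close>

lemma sum_pairs_sample_cov:
  assumes "K \<ge> 1"
  shows "(\<Sum>i<K. \<Sum>j<K. (norm (x i))\<^sup>2 * (norm (x j))\<^sup>2 + outer_H (x i) \<bullet> outer_H (x j))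
    = (real K)\<^sup>2 * ((rtrace (sample_cov K x))\<^sup>2 + (norm (sample_cov K x))\<^sup>2)"
proof -
  have "(\<Sum>k<K. (norm (x k))\<^sup>2) = real K * rtrace (sample_cov K x)"
    "(\<Sum>k<K. outer_H (x k)) = real K *\<^sub>R sample_cov K x"
    using assms by (simp_all add: rtrace_sample_cov) (simp add: sample_cov_def)
  moreover have "(\<Sum>i<K. \<Sum>j<K. (norm (x i))\<^sup>2 * (norm (x j))\<^sup>2 + outer_H (x i) \<bullet> outer_H (x j))
      = (\<Sum>k<K. (norm (x k))\<^sup>2)\<^sup>2 + (norm (\<Sum>k<K. outer_H (x k)))\<^sup>2"
    by (simp add: sum.distrib power2_norm_eq_inner inner_sum_left inner_sum_right)
      (subst sum.swap, simp add: power2_eq_square sum_product)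
  ultimately show ?thesis
    by (simp add: power_mult_distrib ring_distribs)
qed

section \<open>Effect of a unitary mix on outer products and norms\<close>

lemma outer_H_unitary_mix:
  assumes "cmod c = 1"
  shows "outer_H (fst (unitary_mix c z)) + outer_H (snd (unitary_mix c z)) = outer_H (fst z) + outer_H (snd z)"
proof -
  have c: "c * (cnj c * w) = w" for w
    using assms complex_norm_square[of c] by (simp flip: mult.assoc)
  have s: "complex_of_real (sqrt 2) * (complex_of_real (sqrt 2) * w) = 2 * w" for w
    by (simp flip: mult.assoc of_real_mult)
  show ?thesis
    by (simp add: vec_eq_iff outer_H_def unitary_mix_def scaleR_conv_of_real[where 'a = complex] field_simps c s)
qed

text \<open>The cross term occurs with opposite signs in the two squared norms; when their squares
  are added, only its square survives.\<close>

lemma norm_unitary_mix: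
  assumes "cmod c = 1"
  shows "(norm (fst (unitary_mix c (x, y))))\<^sup>2 = ((norm x)\<^sup>2 + (norm y)\<^sup>2) / 2 + x \<bullet> (c *s y)"
    and "(norm (snd (unitary_mix c (x, y))))\<^sup>2 = ((norm x)\<^sup>2 + (norm y)\<^sup>2) / 2 - x \<bullet> (c *s y)"
proof -
  have "cnj c * c = 1"
    using assms complex_norm_square[of c] by (simp add: mult.commute)
  then have "cnj c *s (c *s y) = y"
    by (simp add: vec_eq_iff flip: mult.assoc)
  then have "(c *s y) \<bullet> (c *s y) = (norm y)\<^sup>2"
    by (simp add: inner_scalar_mult_right inner_commute power2_norm_eq_inner)
  then show "(norm (fst (unitary_mix c (x, y))))\<^sup>2 = ((norm x)\<^sup>2 + (norm y)\<^sup>2) / 2 + x \<bullet> (c *s y)"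
    "(norm (snd (unitary_mix c (x, y))))\<^sup>2 = ((norm x)\<^sup>2 + (norm y)\<^sup>2) / 2 - x \<bullet> (c *s y)"
    by (simp_all add: unitary_mix_def power_divide power2_norm_eq_inner inner_add_left inner_add_right
        inner_diff_left inner_diff_right inner_commute field_simps)
qed

text \<open>The phases \<open>1\<close> and \<open>\<i>\<close> contribute the real and the imaginary part of \<open>x\<^sup>H y\<close>, so these
  two suffice in place of an average over the unitary group.\<close>

lemma norm_pow4_unitary_mix:
  "(\<Sum>c\<in>{1, \<i>}. (norm (fst (unitary_mix c (x, y))))^4 + (norm (snd (unitary_mix c (x, y))))^4)
    = (norm x)^4 + (norm y)^4 + 2 * ((norm x)\<^sup>2 * (norm y)\<^sup>2 + outer_H x \<bullet> outer_H y)"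
proof -
  have pow4: "r^4 = (r\<^sup>2)\<^sup>2" for r :: real
    by simp
  have sum2: "sum f {1, \<i>} = f 1 + f \<i>" for f :: "complex \<Rightarrow> real"
    by (simp add: complex_eq_iff)
  show ?thesis
    unfolding sum2 pow4 norm_unitary_mix[OF norm_one] norm_unitary_mix[OF norm_ii] inner_outer_H
    by (simp add: power2_sum power2_diff) (simp add: field_simps power2_eq_square power4_eq_xxxx)
qed

section \<open>Mixing two of the snapshots\<close>

lemma measurable_upd_two:
  assumes x: "x \<in> space (Pi\<^sub>M (I - {i, j}) (\<lambda>_. N))" and ij: "i \<in> I" "j \<in> I" "i \<noteq> j"
  shows "(\<lambda>z. x(i := fst z, j := snd z)) \<in> N \<Otimes>\<^sub>M N \<rightarrow>\<^sub>M Pi\<^sub>M I (\<lambda>_. N)"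
proof (rule measurable_fun_upd)
  show "I = (I - {j}) \<union> {j}"
    using ij by blast
  show "(\<lambda>z. x(i := fst z)) \<in> N \<Otimes>\<^sub>M N \<rightarrow>\<^sub>M Pi\<^sub>M (I - {j}) (\<lambda>_. N)"
  proof (rule measurable_fun_upd)
    show "I - {j} = (I - {i, j}) \<union> {i}"
      using ij by blast
  qed (use x in measurable)
qed measurable

lemma nn_integral_PiM_two:
  assumes "prob_space N" "finite I" "i \<in> I" "j \<in> I" "i \<noteq> j"
    and f [measurable]: "f \<in> borel_measurable (Pi\<^sub>M I (\<lambda>_. N))"
  shows "(\<integral>\<^sup>+x. f x \<partial>Pi\<^sub>M I (\<lambda>_. N))
    = (\<integral>\<^sup>+x. \<integral>\<^sup>+z. f (x(i := fst z, j := snd z)) \<partial>(N \<Otimes>\<^sub>M N) \<partial>Pi\<^sub>M (I - {i, j}) (\<lambda>_. N))"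
proof -
  interpret N: prob_space N by fact
  interpret P: product_sigma_finite "\<lambda>_. N" ..
  have I: "I = (I - {i, j}) \<union> {i, j}"
    using assms by auto
  have "(\<integral>\<^sup>+x. f x \<partial>Pi\<^sub>M I (\<lambda>_. N)) = (\<integral>\<^sup>+x. \<integral>\<^sup>+y. f (merge (I - {i, j}) {i, j} (x, y))
      \<partial>Pi\<^sub>M {i, j} (\<lambda>_. N) \<partial>Pi\<^sub>M (I - {i, j}) (\<lambda>_. N))"
    using assms by (intro P.product_nn_integral_fold[of "I - {i, j}" "{i, j}" f, folded I]) auto
  also have "\<dots> = (\<integral>\<^sup>+x. \<integral>\<^sup>+z. f (x(i := fst z, j := snd z)) \<partial>(N \<Otimes>\<^sub>M N) \<partial>Pi\<^sub>M (I - {i, j}) (\<lambda>_. N))"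
  proof (rule nn_integral_cong)
    fix x assume x: "x \<in> space (Pi\<^sub>M (I - {i, j}) (\<lambda>_. N))"
    have [measurable]: "(\<lambda>z. x(i := fst z, j := snd z)) \<in> N \<Otimes>\<^sub>M N \<rightarrow>\<^sub>M Pi\<^sub>M I (\<lambda>_. N)"
      using x assms(3-5) by (rule measurable_upd_two)
    \<comment> \<open>\<open>merge\<close> is undefined outside \<open>I\<close>, and so is
      \<open>x\<close> by extensionality; hence the two functions agree everywhere.\<close>
    have "merge (I - {i, j}) {i, j} (x, y) = x(i := y i, j := y j)" for y
      using x by (auto simp: merge_def fun_eq_iff space_PiM PiE_def extensional_def)
    then have "(\<integral>\<^sup>+y. f (merge (I - {i, j}) {i, j} (x, y)) \<partial>Pi\<^sub>M {i, j} (\<lambda>_. N))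
        = (\<integral>\<^sup>+y. f (x(i := y i, j := y j)) \<partial>Pi\<^sub>M {i, j} (\<lambda>_. N))"
      by simp
    also have "\<dots> = (\<integral>\<^sup>+z. f (x(i := fst z, j := snd z)) \<partial>(N \<Otimes>\<^sub>M N))"
    proof (rule P.product_nn_integral_pair[OF _ assms(5)])
      show "(\<lambda>(a, b). f (x(i := a, j := b))) \<in> borel_measurable (N \<Otimes>\<^sub>M N)"
        unfolding case_prod_beta' by measurable
    qed
    finally show "(\<integral>\<^sup>+y. f (merge (I - {i, j}) {i, j} (x, y)) \<partial>Pi\<^sub>M {i, j} (\<lambda>_. N))
        = (\<integral>\<^sup>+z. f (x(i := fst z, j := snd z)) \<partial>(N \<Otimes>\<^sub>M N))" .
  qed
  finally show ?thesis .
qed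

definition mix_at :: "complex \<Rightarrow> 'i \<Rightarrow> 'i \<Rightarrow> ('i \<Rightarrow> complex^'p) \<Rightarrow> 'i \<Rightarrow> complex^'p"
  where "mix_at c i j x
    = x(i := fst (unitary_mix c (x i, x j)), j := snd (unitary_mix c (x i, x j)))"

lemma measurable_mix_at:
  fixes N :: "(complex^'p) measure"
  assumes [measurable_cong]: "sets N = sets borel" and ij: "i \<in> I" "j \<in> I"
  shows "mix_at c i j \<in> Pi\<^sub>M I (\<lambda>_. N) \<rightarrow>\<^sub>M Pi\<^sub>M I (\<lambda>_. N)"
proof -
  have [measurable]: "(\<lambda>x. x i) \<in> Pi\<^sub>M I (\<lambda>_. N) \<rightarrow>\<^sub>M N" "(\<lambda>x. x j) \<in> Pi\<^sub>M I (\<lambda>_. N) \<rightarrow>\<^sub>M N"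
    using ij by (auto intro: measurable_component_singleton)
  then have [measurable]: "(\<lambda>x. unitary_mix c (x i, x j)) \<in> Pi\<^sub>M I (\<lambda>_. N) \<rightarrow>\<^sub>M borel \<Otimes>\<^sub>M borel"
    by (intro measurable_compose[OF measurable_Pair borel_measurable_unitary_mix])
      (simp_all add: measurable_cong_sets[OF refl assms(1)])
  show ?thesis
    unfolding mix_at_def[abs_def]
  proof (rule measurable_fun_upd)
    show "(\<lambda>x. x(i := fst (unitary_mix c (x i, x j)))) \<in> Pi\<^sub>M I (\<lambda>_. N) \<rightarrow>\<^sub>M Pi\<^sub>M I (\<lambda>_. N)"
    proof (rule measurable_fun_upd)
      show "I = I \<union> {i}"
        using ij by blast
    qed measurable
    show "I = I \<union> {j}"
      using ij by blast
  qed measurable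
qed

lemma distr_mix_at:
  fixes N :: "(complex^'p) measure"
  assumes circ: "circular_complex_gaussian N S" and c: "c = 1 \<or> c = \<i>"
    and I: "finite I" "i \<in> I" "j \<in> I" "i \<noteq> j"
  shows "distr (Pi\<^sub>M I (\<lambda>_. N)) (Pi\<^sub>M I (\<lambda>_. N)) (mix_at c i j) = Pi\<^sub>M I (\<lambda>_. N)" (is "distr ?Q ?Q ?T = ?Q")
proof (rule measure_eqI)
  have N: "prob_space N" "sets N = sets borel"
    using circ by (auto simp: circular_complex_gaussian_def gaussian_law_def)
  note [measurable_cong] = N(2)
  have [measurable]: "?T \<in> ?Q \<rightarrow>\<^sub>M ?Q"
    using N(2) I(2,3) by (rule measurable_mix_at)
  have [measurable]: "unitary_mix c \<in> N \<Otimes>\<^sub>M N \<rightarrow>\<^sub>M N \<Otimes>\<^sub>M N"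
    by measurable
  fix A assume "A \<in> sets (distr ?Q ?Q ?T)"
  then have A [measurable]: "A \<in> sets ?Q"
    by simp
  let ?upd = "\<lambda>x z. x(i := fst z, j := snd z)"
  \<comment> \<open>Since \<open>i \<noteq> j\<close>, mixing an updated sample is updating with the
    mixed pair, so the mix acts on the inner integral alone.\<close>
  have mix_upd: "?T (?upd x z) = ?upd x (unitary_mix c z)" for x z
    using I(4) by (auto simp: mix_at_def fun_eq_iff)
  have "emeasure (distr ?Q ?Q ?T) A = (\<integral>\<^sup>+x. indicator A (?T x) \<partial>?Q)"
    by (simp add: nn_integral_distr flip: nn_integral_indicator)
  also have "\<dots> = (\<integral>\<^sup>+x. \<integral>\<^sup>+z. indicator A (?upd x (unitary_mix c z)) \<partial>(N \<Otimes>\<^sub>M N)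
      \<partial>Pi\<^sub>M (I - {i, j}) (\<lambda>_. N))"
    unfolding mix_upd[symmetric] by (rule nn_integral_PiM_two[OF N(1) I]) measurable
  also have "\<dots> = (\<integral>\<^sup>+x. \<integral>\<^sup>+z. indicator A (?upd x z) \<partial>(N \<Otimes>\<^sub>M N) \<partial>Pi\<^sub>M (I - {i, j}) (\<lambda>_. N))"
  proof (rule nn_integral_cong)
    fix x assume x: "x \<in> space (Pi\<^sub>M (I - {i, j}) (\<lambda>_. N))"
    have [measurable]: "?upd x \<in> N \<Otimes>\<^sub>M N \<rightarrow>\<^sub>M ?Q"
      using x I(2-4) by (rule measurable_upd_two)
    have "(\<integral>\<^sup>+z. indicator A (?upd x (unitary_mix c z)) \<partial>(N \<Otimes>\<^sub>M N))
        = (\<integral>\<^sup>+z. indicator A (?upd x z) \<partial>distr (N \<Otimes>\<^sub>M N) (N \<Otimes>\<^sub>M N) (unitary_mix c))"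
      by (rule nn_integral_distr[symmetric]) measurable
    then show "(\<integral>\<^sup>+z. indicator A (?upd x (unitary_mix c z)) \<partial>(N \<Otimes>\<^sub>M N))
        = (\<integral>\<^sup>+z. indicator A (?upd x z) \<partial>(N \<Otimes>\<^sub>M N))"
      unfolding distr_unitary_mix[OF circ c] .
  qed
  also have "\<dots> = (\<integral>\<^sup>+x. indicator A x \<partial>?Q)"
    by (rule nn_integral_PiM_two[OF N(1) I, symmetric]) measurable
  finally show "emeasure (distr ?Q ?Q ?T) A = emeasure ?Q A"
    by simp
qed simp

lemma sample_cov_mix_at:
  assumes "cmod c = 1" "i < K" "j < K" "i \<noteq> j"
  shows "sample_cov K (mix_at c i j x) = sample_cov K x"
proof -
  have split: "(\<Sum>k<K. F k) = F i + F j + (\<Sum>k\<in>{..<K} - {i, j}. F k)" for F :: "nat \<Rightarrow> complex^'a^'a"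
    using assms by (subst sum.subset_diff[of "{i, j}"]) (auto simp: add.commute)
  show ?thesis
    unfolding sample_cov_def split
    using outer_H_unitary_mix[OF assms(1), of "(x i, x j)"] assms(4)
    by (auto simp: mix_at_def intro!: sum.cong arg_cong2[of _ _ _ _ "(+)"])
qed

section \<open>Integrals against functions of the sample covariance\<close>

lemma borel_measurable_outer_H [measurable]: "outer_H \<in> borel_measurable borel"
  unfolding outer_H_def[abs_def]
  by (intro borel_measurable_continuous_onI continuous_intros)

lemma borel_measurable_rtrace [measurable]: "rtrace \<in> borel_measurable borel"
  unfolding rtrace_eq_inner[abs_def] by measurable

lemma borel_measurable_matrix_square [measurable]:
  "(\<lambda>A :: complex^'n^'n. A ** A) \<in> borel_measurable borel"
  unfolding matrix_matrix_mult_def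
  by (intro borel_measurable_continuous_onI continuous_intros)

lemma borel_measurable_LW_bracket [measurable]: "LW_bracket \<in> borel_measurable borel"
  unfolding LW_bracket_def[abs_def] by measurable

lemma borel_measurable_sample_cov:
  assumes "\<And>k. k < K \<Longrightarrow> (\<lambda>\<omega>. X \<omega> k) \<in> borel_measurable M"
  shows "(\<lambda>\<omega>. sample_cov K (X \<omega>)) \<in> borel_measurable M"
  unfolding sample_cov_def
  by (intro borel_measurable_scaleR borel_measurable_const borel_measurable_sum
      measurable_compose[OF _ borel_measurable_outer_H] assms) auto

lemma borel_measurable_LW_numerator:
  assumes "\<And>k. k < K \<Longrightarrow> (\<lambda>\<omega>. X \<omega> k) \<in> borel_measurable M"
  shows "(\<lambda>\<omega>. LW_numerator K (X \<omega>)) \<in> borel_measurable M"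
  unfolding LW_numerator_def frobenius_norm_eq_norm
proof (rule borel_measurable_sum)
  fix k assume "k \<in> {..<K}"
  then have [measurable]: "(\<lambda>\<omega>. X \<omega> k) \<in> borel_measurable M"
    by (simp add: assms)
  have [measurable]: "(\<lambda>\<omega>. sample_cov K (X \<omega>)) \<in> borel_measurable M"
    by (rule borel_measurable_sample_cov) (rule assms)
  show "(\<lambda>\<omega>. (norm (outer_H (X \<omega> k) - sample_cov K (X \<omega>)))\<^sup>2) \<in> borel_measurable M"
    by measurable
qed

section \<open>Bounds by the trace and the Rao-Blackwell numerator\<close>

lemma norm_le_rtrace_sample_cov:
  assumes "k < K"
  shows "(norm (x k))\<^sup>2 \<le> real K * rtrace (sample_cov K x)"
  using assms by (auto simp: rtrace_sample_cov intro!: member_le_sum)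

text \<open>The value that the conditional expectation of \<open>LW_numerator\<close> will turn out
  to have when the sample covariance is \<open>A\<close>; the factor \<open>K\<^sup>2\<close>
  cancels against the denominator of \<open>rho_LW\<close>.\<close>

definition RB_numerator :: "nat \<Rightarrow> complex^'p^'p \<Rightarrow> real"
  where "RB_numerator K A = (real K)\<^sup>2 * ((rtrace A)\<^sup>2 - rtrace (A ** A) / real K) / (real K + 1)"

lemma borel_measurable_RB_numerator [measurable]: "RB_numerator K \<in> borel_measurable borel"
  unfolding RB_numerator_def[abs_def] by measurable

lemma RB_numerator_nonneg: "0 \<le> RB_numerator K (sample_cov K x)"
proof -
  have "(norm (sample_cov K x))\<^sup>2 / real K \<le> (norm (sample_cov K x))\<^sup>2"
    \<comment> \<open>For \<open>K = 0\<close> the quotient is 0 by the convention for division by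
      zero.\<close>
    by (cases "K = 0") (auto simp: divide_le_eq mult_le_cancel_left1)
  also have "\<dots> \<le> (rtrace (sample_cov K x))\<^sup>2"
    by (intro power_mono norm_sample_cov_le norm_ge_zero)
  finally show ?thesis
    by (simp add: RB_numerator_def rtrace_square_hermitian[OF hermitian_sample_cov])
qed

text \<open>\<open>u\<close> is the test function for conditional expectations. The integrands it
  multiplies are quadratic in the outer products and dominated by a multiple of the squared trace,
  hence the form of the bound by \<open>C\<close>.\<close>

locale gaussian_sample =
  fixes N :: "(complex^'p) measure" and S :: "complex^'p^'p" and K :: nat
    and Q :: "(nat \<Rightarrow> complex^'p) measure" and u :: "complex^'p^'p \<Rightarrow> real" and C :: real
  assumes circ: "circular_complex_gaussian N S" and K: "K \<ge> 1"
    and u_meas [measurable]: "u \<in> borel_measurable borel"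
    and u_nonneg: "\<And>A. 0 \<le> u A" and u_bound: "\<And>A. u A * (rtrace A)\<^sup>2 \<le> C"
  defines "Q \<equiv> Pi\<^sub>M {..<K} (\<lambda>_. N)"
begin

lemma sets_N [measurable_cong]: "sets N = sets borel"
  using circ by (auto simp: circular_complex_gaussian_def gaussian_law_def)

sublocale N: prob_space N
  using circ by (auto simp: circular_complex_gaussian_def gaussian_law_def)

sublocale Q: prob_space Q
  unfolding Q_def by (intro prob_space_PiM N.prob_space_axioms)

lemma measurable_component [measurable (raw)]: "k < K \<Longrightarrow> (\<lambda>x. x k) \<in> Q \<rightarrow>\<^sub>M borel"
  using measurable_component_singleton[of k "{..<K}" "\<lambda>_. N"]
  by (simp add: Q_def measurable_cong_sets[OF refl sets_N])

lemma measurable_cov [measurable]: "sample_cov K \<in> borel_measurable Q"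
  by (rule borel_measurable_sample_cov) measurable

lemma integrable_weighted:
  assumes [measurable]: "h \<in> borel_measurable Q"
    and "\<And>x. \<bar>h x\<bar> \<le> D * (rtrace (sample_cov K x))\<^sup>2" and "0 \<le> D"
  shows "integrable Q (\<lambda>x. u (sample_cov K x) * h x)"
proof (rule Q.integrable_const_bound)
  have "\<bar>u (sample_cov K x) * h x\<bar> \<le> D * C" for x
  proof -
    have "\<bar>u (sample_cov K x) * h x\<bar> \<le> u (sample_cov K x) * (D * (rtrace (sample_cov K x))\<^sup>2)"
      using assms(2)[of x] u_nonneg by (simp add: abs_mult mult_left_mono)
    also have "\<dots> = D * (u (sample_cov K x) * (rtrace (sample_cov K x))\<^sup>2)"
      by simp
    also have "\<dots> \<le> D * C"
      using u_bound assms(3) by (intro mult_left_mono) auto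
    finally show ?thesis .
  qed
  then show "AE x in Q. norm (u (sample_cov K x) * h x) \<le> D * C"
    by simp
qed measurable

lemma norm_product_bound:
  assumes "i < K" "j < K"
  shows "\<bar>(norm (x i))\<^sup>2 * (norm (x j))\<^sup>2\<bar> \<le> (real K)\<^sup>2 * (rtrace (sample_cov K x))\<^sup>2"
proof -
  have "(norm (x i))\<^sup>2 * (norm (x j))\<^sup>2
      \<le> (real K * rtrace (sample_cov K x)) * (real K * rtrace (sample_cov K x))"
    using norm_le_rtrace_sample_cov[OF assms(1), of x] norm_le_rtrace_sample_cov[OF assms(2), of x]
      order_trans[OF zero_le_power2 norm_le_rtrace_sample_cov[OF assms(1), of x]]
    by (intro mult_mono) auto
  then show ?thesis
    by (simp add: power2_eq_square mult_ac)
qed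

lemma integrable_norms:
  assumes "i < K" "j < K"
  shows "integrable Q (\<lambda>x. u (sample_cov K x) * ((norm (x i))\<^sup>2 * (norm (x j))\<^sup>2))"
  using assms norm_product_bound[OF assms] by (intro integrable_weighted[where D = "(real K)\<^sup>2"]) auto

lemma integrable_pow4:
  assumes "k < K"
  shows "integrable Q (\<lambda>x. u (sample_cov K x) * (norm (x k))^4)"
  using integrable_norms[OF assms assms] by (simp flip: power_add)

lemma integrable_inner:
  assumes "i < K" "j < K"
  shows "integrable Q (\<lambda>x. u (sample_cov K x) * (outer_H (x i) \<bullet> outer_H (x j)))"
proof (rule integrable_weighted[where D = "(real K)\<^sup>2"])
  show "\<bar>outer_H (x i) \<bullet> outer_H (x j)\<bar> \<le> (real K)\<^sup>2 * (rtrace (sample_cov K x))\<^sup>2" for x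
    using Cauchy_Schwarz_ineq2[of "outer_H (x i)" "outer_H (x j)"] norm_product_bound[OF assms, of x]
    by (simp add: norm_outer_H)
qed (use assms in measurable)

lemma integral_pair:
  assumes "i < K" "j < K" "i \<noteq> j"
  shows "(LINT x|Q. u (sample_cov K x) * (norm (x i))^4) + (LINT x|Q. u (sample_cov K x) * (norm (x j))^4)
    = 2 * (LINT x|Q. u (sample_cov K x) * ((norm (x i))\<^sup>2 * (norm (x j))\<^sup>2 + outer_H (x i) \<bullet> outer_H (x j)))"
proof -
  define g where "g x = u (sample_cov K x) * ((norm (x i))^4 + (norm (x j))^4)" for x
  define r where "r x = u (sample_cov K x) *
    ((norm (x i))\<^sup>2 * (norm (x j))\<^sup>2 + outer_H (x i) \<bullet> outer_H (x j))" for x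
  have int_g: "integrable Q g"
    unfolding g_def[abs_def] distrib_left using assms by (intro Bochner_Integration.integrable_add integrable_pow4)
  have int_r: "integrable Q r"
    unfolding r_def[abs_def] distrib_left using assms
    by (intro Bochner_Integration.integrable_add integrable_norms integrable_inner)
  have g_eq: "(LINT x|Q. g x)
      = (LINT x|Q. u (sample_cov K x) * (norm (x i))^4) + (LINT x|Q. u (sample_cov K x) * (norm (x j))^4)"
    unfolding g_def distrib_left using assms by (intro Bochner_Integration.integral_add integrable_pow4)
  have mix: "integrable Q (\<lambda>x. g (mix_at c i j x))" "(LINT x|Q. g (mix_at c i j x)) = (LINT x|Q. g x)"
    if c: "c = 1 \<or> c = \<i>" for c
  proof -
    have [measurable]: "mix_at c i j \<in> Q \<rightarrow>\<^sub>M Q"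
      unfolding Q_def using assms by (intro measurable_mix_at sets_N) auto
    have distr: "distr Q Q (mix_at c i j) = Q"
      unfolding Q_def using assms by (intro distr_mix_at[OF circ c]) auto
    have [measurable]: "g \<in> borel_measurable Q"
      using int_g by auto
    have "integrable (distr Q Q (mix_at c i j)) g \<longleftrightarrow> integrable Q (\<lambda>x. g (mix_at c i j x))"
      by (rule integrable_distr_eq) measurable
    then show "integrable Q (\<lambda>x. g (mix_at c i j x))"
      using int_g by (simp add: distr)
    have "(LINT x|distr Q Q (mix_at c i j). g x) = (LINT x|Q. g (mix_at c i j x))"
      by (rule integral_distr) measurable
    then show "(LINT x|Q. g (mix_at c i j x)) = (LINT x|Q. g x)"
      by (simp add: distr)
  qed
  have sum2: "sum f {1, \<i>} = f 1 + f \<i>" for f :: "complex \<Rightarrow> real"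
    by (simp add: complex_eq_iff)
  have pointwise: "g (mix_at 1 i j x) + g (mix_at \<i> i j x) = g x + 2 * r x" for x
  proof -
    have g_mix: "g (mix_at c i j x) = u (sample_cov K x) *
        ((norm (fst (unitary_mix c (x i, x j))))^4 + (norm (snd (unitary_mix c (x i, x j))))^4)"
      if "cmod c = 1" for c
      using assms that by (simp add: g_def sample_cov_mix_at) (simp add: mix_at_def)
    have "g (mix_at 1 i j x) + g (mix_at \<i> i j x) = u (sample_cov K x) * (\<Sum>c\<in>{1, \<i>}.
        (norm (fst (unitary_mix c (x i, x j))))^4 + (norm (snd (unitary_mix c (x i, x j))))^4)"
      by (simp only: g_mix norm_one norm_ii sum2 distrib_left)
    also have "\<dots> = g x + 2 * r x"
      unfolding norm_pow4_unitary_mix g_def r_def by (simp only: distrib_left mult.left_commute[of 2])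
    finally show ?thesis .
  qed
  \<comment> \<open>Each mix preserves the integral of \<open>g\<close>, while the two mixed
    integrands add up to \<open>g + 2 r\<close>; one copy of the integral of \<open>g\<close>
    cancels.\<close>
  have "2 * (LINT x|Q. g x) = (LINT x|Q. g (mix_at 1 i j x)) + (LINT x|Q. g (mix_at \<i> i j x))"
    by (simp add: mix)
  also have "\<dots> = (LINT x|Q. g x + 2 * r x)"
    by (subst Bochner_Integration.integral_add[symmetric]) (simp_all add: mix pointwise)
  also have "\<dots> = (LINT x|Q. g x) + 2 * (LINT x|Q. r x)"
    using int_g int_r by simp
  finally show ?thesis
    unfolding g_eq[symmetric] r_def by simp
qed

lemma integral_sum_pow4:
  "(real K + 1) * (LINT x|Q. u (sample_cov K x) * (\<Sum>k<K. (norm (x k))^4))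
    = (real K)\<^sup>2 * (LINT x|Q. u (sample_cov K x) *
        ((rtrace (sample_cov K x))\<^sup>2 + (norm (sample_cov K x))\<^sup>2))"
proof -
  define e where "e k = (LINT x|Q. u (sample_cov K x) * (norm (x k))^4)" for k
  define f where "f i j = (LINT x|Q. u (sample_cov K x) *
    ((norm (x i))\<^sup>2 * (norm (x j))\<^sup>2 + outer_H (x i) \<bullet> outer_H (x j)))" for i j
  have int: "integrable Q (\<lambda>x. u (sample_cov K x) *
      ((norm (x i))\<^sup>2 * (norm (x j))\<^sup>2 + outer_H (x i) \<bullet> outer_H (x j)))" if "i < K" "j < K" for i j
    unfolding distrib_left using that
    by (intro Bochner_Integration.integrable_add integrable_norms integrable_inner)
  \<comment> \<open>On the diagonal \<open>|x^H x|\<^sup>2 = |x|\<^sup>4\<close>, so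
    \<open>f i i\<close> is \<open>2 * e i\<close>, one \<open>e i\<close> more than the
    off-diagonal pattern. Summation yields \<open>K\<close> from the averages and 1 from the
    diagonal: the origin of the factor \<open>K + 1\<close>.\<close>
  have f_eq: "f i j = (e i + e j) / 2 + (if i = j then e i else 0)" if "i < K" "j < K" for i j
  proof (cases "i = j")
    case True
    have pow4: "a * (b\<^sup>2 * b\<^sup>2 + (b\<^sup>2)\<^sup>2) = 2 * (a * b^4)" for a b :: real
      by (simp flip: power_add power_mult)
    then show ?thesis
      unfolding f_def e_def True power2_norm_eq_inner[symmetric] norm_outer_H pow4
      by simp
  next
    case False
    then show ?thesis
      using integral_pair[OF that] by (simp add: e_def f_def)
  qed
  have "(real K)\<^sup>2 * (LINT x|Q. u (sample_cov K x) * ((rtrace (sample_cov K x))\<^sup>2 + (norm (sample_cov K x))\<^sup>2))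
      = (LINT x|Q. u (sample_cov K x) * (\<Sum>i<K. \<Sum>j<K. (norm (x i))\<^sup>2 * (norm (x j))\<^sup>2
          + outer_H (x i) \<bullet> outer_H (x j)))"
    unfolding sum_pairs_sample_cov[OF K] by (simp add: mult.left_commute[of _ "(real K)\<^sup>2"])
  also have "\<dots> = (\<Sum>i<K. LINT x|Q. (\<Sum>j<K. u (sample_cov K x) *
      ((norm (x i))\<^sup>2 * (norm (x j))\<^sup>2 + outer_H (x i) \<bullet> outer_H (x j))))"
    unfolding sum_distrib_left
    by (rule Bochner_Integration.integral_sum) (auto intro!: Bochner_Integration.integrable_sum int)
  also have "\<dots> = (\<Sum>i<K. \<Sum>j<K. f i j)"
    unfolding f_def by (intro sum.cong refl Bochner_Integration.integral_sum) (auto intro!: int)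
  also have "\<dots> = (\<Sum>i<K. \<Sum>j<K. (e i + e j) / 2 + (if i = j then e i else 0))"
    by (intro sum.cong refl f_eq) auto
  also have "\<dots> = (real K + 1) * (\<Sum>k<K. e k)"
    by (simp add: sum.distrib flip: sum_divide_distrib sum_distrib_left) (simp add: field_simps)
  also have "(\<Sum>k<K. e k) = (LINT x|Q. u (sample_cov K x) * (\<Sum>k<K. (norm (x k))^4))"
    unfolding sum_distrib_left e_def
    by (rule Bochner_Integration.integral_sum[symmetric]) (auto intro: integrable_pow4)
  finally show ?thesis ..
qed

lemma norm_sample_cov_square_le:
  "\<bar>(norm (sample_cov K x))\<^sup>2\<bar> \<le> 1 * (rtrace (sample_cov K x))\<^sup>2"
  by (simp add: power_mono norm_sample_cov_le)

lemma integrable_RB_numerator: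
  "integrable Q (\<lambda>x. u (sample_cov K x) * RB_numerator K (sample_cov K x))"
proof -
  have "RB_numerator K A \<le> (real K)\<^sup>2 / (real K + 1) * (rtrace A)\<^sup>2"
    if "hermitian A" for A :: "complex^'p^'p"
    by (simp add: RB_numerator_def rtrace_square_hermitian[OF that] divide_right_mono mult_left_mono)
  then show ?thesis
    by (intro integrable_weighted[where D = "(real K)\<^sup>2 / (real K + 1)"])
      (auto simp: RB_numerator_nonneg hermitian_sample_cov)
qed

lemma integrable_LW_numerator:
  "integrable Q (\<lambda>x. u (sample_cov K x) * LW_numerator K x)"
proof -
  have "integrable Q (\<lambda>x. u (sample_cov K x) * (\<Sum>k<K. (norm (x k))^4))"
    unfolding sum_distrib_left by (intro Bochner_Integration.integrable_sum integrable_pow4) simp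
  moreover have "integrable Q (\<lambda>x. real K * (u (sample_cov K x) * (norm (sample_cov K x))\<^sup>2))"
    by (intro integrable_mult_right integrable_weighted[OF _ norm_sample_cov_square_le]) auto
  ultimately show ?thesis
    by (simp add: LW_numerator_eq[OF K] right_diff_distrib mult.left_commute)
qed

lemma integral_LW_numerator:
  "(LINT x|Q. u (sample_cov K x) * LW_numerator K x)
    = (LINT x|Q. u (sample_cov K x) * RB_numerator K (sample_cov K x))"
proof -
  define T where "T = (LINT x|Q. u (sample_cov K x) * (rtrace (sample_cov K x))\<^sup>2)"
  define F where "F = (LINT x|Q. u (sample_cov K x) * (norm (sample_cov K x))\<^sup>2)"
  define P where "P = (LINT x|Q. u (sample_cov K x) * (\<Sum>k<K. (norm (x k))^4))"
  have "(norm (sample_cov K x))\<^sup>2 \<le> (rtrace (sample_cov K x))\<^sup>2" for x :: "nat \<Rightarrow> complex^'p"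
    by (intro power_mono norm_sample_cov_le norm_ge_zero)
  then have int: "integrable Q (\<lambda>x. u (sample_cov K x) * (rtrace (sample_cov K x))\<^sup>2)"
    "integrable Q (\<lambda>x. u (sample_cov K x) * (norm (sample_cov K x))\<^sup>2)"
    by (auto intro!: integrable_weighted[where D = 1])
  have int_P: "integrable Q (\<lambda>x. u (sample_cov K x) * (\<Sum>k<K. (norm (x k))^4))"
    unfolding sum_distrib_left by (intro Bochner_Integration.integrable_sum integrable_pow4) simp
  have P: "(real K + 1) * P = (real K)\<^sup>2 * (T + F)"
    using integral_sum_pow4 int by (simp add: P_def T_def F_def distrib_left)
  have "(LINT x|Q. u (sample_cov K x) * LW_numerator K x)
      = (LINT x|Q. u (sample_cov K x) * (\<Sum>k<K. (norm (x k))^4)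
          - real K * (u (sample_cov K x) * (norm (sample_cov K x))\<^sup>2))"
    by (simp add: LW_numerator_eq[OF K] right_diff_distrib mult.left_commute)
  also have "\<dots> = P - real K * F"
    using int int_P by (simp add: P_def F_def)
  also have "P = (real K)\<^sup>2 * (T + F) / (real K + 1)"
    using P by (simp add: nonzero_eq_divide_eq mult.commute)
  \<comment> \<open>The coefficient of \<open>F\<close> is
    \<open>K\<^sup>2 / (K + 1) - K = - K / (K + 1)\<close>; with \<open>K\<^sup>2 / (K + 1)\<close>
    factored out it becomes the \<open>- 1 / K\<close> of the final formula.\<close>
  also have "\<dots> - real K * F = (real K)\<^sup>2 / (real K + 1) * T - real K / (real K + 1) * F"
    by (simp add: divide_simps) (simp add: algebra_simps power2_eq_square)
  also have "\<dots> = (LINT x|Q. (real K)\<^sup>2 / (real K + 1) * (u (sample_cov K x) * (rtrace (sample_cov K x))\<^sup>2)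
      - real K / (real K + 1) * (u (sample_cov K x) * (norm (sample_cov K x))\<^sup>2))"
    using int by (simp add: T_def F_def)
  also have "\<dots> = (LINT x|Q. u (sample_cov K x) * RB_numerator K (sample_cov K x))"
  proof (rule Bochner_Integration.integral_cong)
    show "(real K)\<^sup>2 / (real K + 1) * (u (sample_cov K x) * (rtrace (sample_cov K x))\<^sup>2)
        - real K / (real K + 1) * (u (sample_cov K x) * (norm (sample_cov K x))\<^sup>2)
        = u (sample_cov K x) * RB_numerator K (sample_cov K x)" for x
      using K by (simp add: RB_numerator_def rtrace_square_hermitian[OF hermitian_sample_cov]
          divide_simps) (simp add: algebra_simps power2_eq_square)
  qed simp
  finally show ?thesis .
qed

end

section \<open>The Rao-Blackwell shrinkage parameter\<close>

text \<open>Only the first \<open>K\<close> values enter, so a family may be replaced by its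
  restriction to \<open>{..<K}\<close>, which is a point of the product space.\<close>

lemma sample_cov_cong:
  assumes "\<And>k. k < K \<Longrightarrow> x k = y k"
  shows "sample_cov K x = sample_cov K y"
  unfolding sample_cov_def using assms by simp

lemma LW_numerator_cong:
  assumes "\<And>k. k < K \<Longrightarrow> x k = y k"
  shows "LW_numerator K x = LW_numerator K y"
  unfolding LW_numerator_def sample_cov_cong[of K x y, OF assms, simplified] using assms by simp

locale gaussian_snapshots = prob_space M
  for M :: "'a measure" +
  fixes J :: "nat \<Rightarrow> 'a \<Rightarrow> complex^'p" and N :: "(complex^'p) measure" and S :: "complex^'p^'p"
    and K :: nat
  assumes K: "K \<ge> 1"
    and circ: "circular_complex_gaussian N S"
    and indep: "indep_vars (\<lambda>_. borel) J {..<K}"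
    and distr_J: "\<And>k. k < K \<Longrightarrow> distr M borel (J k) = N"
begin

abbreviation Shat :: "'a \<Rightarrow> complex^'p^'p"
  where "Shat \<omega> \<equiv> sample_cov K (\<lambda>k. J k \<omega>)"

lemma measurable_J: "k < K \<Longrightarrow> J k \<in> borel_measurable M"
  using indep by (auto simp: indep_vars_def)

lemma measurable_Shat [measurable]: "Shat \<in> borel_measurable M"
  by (rule borel_measurable_sample_cov) (simp add: measurable_J)

lemma measurable_LW [measurable]: "(\<lambda>\<omega>. LW_numerator K (\<lambda>k. J k \<omega>)) \<in> borel_measurable M"
  by (rule borel_measurable_LW_numerator) (simp add: measurable_J)

lemma distr_sample: "distr M (Pi\<^sub>M {..<K} (\<lambda>_. N)) (\<lambda>\<omega>. \<lambda>k\<in>{..<K}. J k \<omega>) = Pi\<^sub>M {..<K} (\<lambda>_. N)"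
proof -
  \<comment> \<open>The characterisation of independence by product laws is applied with a nonempty
    index set.\<close>
  have "{..<K} \<noteq> {}"
    using K by (simp add: lessThan_empty_iff)
  then have "distr M (Pi\<^sub>M {..<K} (\<lambda>_. borel)) (\<lambda>\<omega>. \<lambda>k\<in>{..<K}. J k \<omega>)
      = Pi\<^sub>M {..<K} (\<lambda>k. distr M borel (J k))"
    by (intro indep_vars_iff_distr_eq_PiM'[THEN iffD1, OF _ _ indep]) (simp_all add: measurable_J)
  also have "\<dots> = Pi\<^sub>M {..<K} (\<lambda>_. N)"
    by (intro PiM_cong) (simp_all add: distr_J)
  finally have eq: "distr M (Pi\<^sub>M {..<K} (\<lambda>_. borel)) (\<lambda>\<omega>. \<lambda>k\<in>{..<K}. J k \<omega>) = Pi\<^sub>M {..<K} (\<lambda>_. N)" .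
  \<comment> \<open>\<open>N\<close> and \<open>borel\<close> share their measurable sets but are
    different measures, so the target of the image measure is exchanged separately.\<close>
  have "sets N = sets borel"
    using circ by (auto simp: circular_complex_gaussian_def gaussian_law_def)
  then have "sets (Pi\<^sub>M {..<K} (\<lambda>_. N)) = sets (Pi\<^sub>M {..<K} (\<lambda>_. borel))"
    by (intro sets_PiM_cong) auto
  then have "distr M (Pi\<^sub>M {..<K} (\<lambda>_. N)) (\<lambda>\<omega>. \<lambda>k\<in>{..<K}. J k \<omega>)
      = distr M (Pi\<^sub>M {..<K} (\<lambda>_. borel)) (\<lambda>\<omega>. \<lambda>k\<in>{..<K}. J k \<omega>)"
    by (intro distr_cong) simp_all
  then show ?thesis
    by (simp only: eq)
qed

lemma nn_integral_LW_numerator: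
  assumes u [measurable]: "u \<in> borel_measurable borel"
    and "\<And>A. 0 \<le> u A" "\<And>A. u A * (rtrace A)\<^sup>2 \<le> C"
  shows "(\<integral>\<^sup>+\<omega>. ennreal (u (Shat \<omega>) * LW_numerator K (\<lambda>k. J k \<omega>)) \<partial>M)
    = (\<integral>\<^sup>+\<omega>. ennreal (u (Shat \<omega>) * RB_numerator K (Shat \<omega>)) \<partial>M)"
proof -
  define Q where "Q = Pi\<^sub>M {..<K} (\<lambda>_. N)"
  interpret gaussian_sample N S K Q u C
    using assms K circ by unfold_locales (auto simp: Q_def)
  let ?X = "\<lambda>\<omega>. \<lambda>k\<in>{..<K}. J k \<omega>"
  have X [measurable]: "?X \<in> M \<rightarrow>\<^sub>M Q"
    unfolding Q_def by (intro measurable_restrict) (simp add: measurable_cong_sets[OF refl sets_N] measurable_J)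
  have [measurable]: "LW_numerator K \<in> borel_measurable Q"
    by (rule borel_measurable_LW_numerator) measurable
  have transfer: "(\<integral>\<^sup>+x. h x \<partial>Q) = (\<integral>\<^sup>+\<omega>. h (?X \<omega>) \<partial>M)"
    if "h \<in> borel_measurable Q" for h :: "_ \<Rightarrow> ennreal"
  proof -
    have "(\<integral>\<^sup>+x. h x \<partial>Q) = (\<integral>\<^sup>+x. h x \<partial>distr M Q ?X)"
      by (simp only: distr_sample[folded Q_def])
    also have "\<dots> = (\<integral>\<^sup>+\<omega>. h (?X \<omega>) \<partial>M)"
      by (rule nn_integral_distr) (use X that in simp_all)
    finally show ?thesis .
  qed
  have cong: "sample_cov K (?X \<omega>) = Shat \<omega>" "LW_numerator K (?X \<omega>) = LW_numerator K (\<lambda>k. J k \<omega>)" for \<omega>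
    by (auto intro: sample_cov_cong LW_numerator_cong)
  have "(\<integral>\<^sup>+x. ennreal (u (sample_cov K x) * LW_numerator K x) \<partial>Q)
      = (\<integral>\<^sup>+x. ennreal (u (sample_cov K x) * RB_numerator K (sample_cov K x)) \<partial>Q)"
    by (simp add: nn_integral_eq_integral integrable_LW_numerator integrable_RB_numerator u_nonneg
        LW_numerator_nonneg RB_numerator_nonneg integral_LW_numerator)
  then show ?thesis
    by (simp add: transfer cong)
qed

section \<open>Conditional expectation given the sample covariance\<close>

abbreviation Shat_algebra :: "'a measure"
  where "Shat_algebra \<equiv> vimage_algebra (space M) Shat borel"

sublocale cond: sigma_finite_subalgebra M Shat_algebra
proof (rule finite_measure_subalgebra_is_sigma_finite)
  show "finite_measure_subalgebra M Shat_algebra"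
  proof (unfold_locales, unfold subalgebra_def, intro conjI)
    show "space Shat_algebra = space M"
      by simp
    show "sets Shat_algebra \<subseteq> sets M"
      by (auto simp: sets_vimage_algebra2 intro!: measurable_sets[OF measurable_Shat])
  qed
qed

lemma measurable_Shat_algebra [measurable]: "Shat \<in> borel_measurable Shat_algebra"
  by (rule measurable_vimage_algebra1) simp

text \<open>Divided by \<open>v\<close>, the numerator admits the test-function identity, which
  determines its conditional expectation; the factor \<open>\<gamma> * v\<close> of
  \<open>Shat\<close> is then pulled out. Nonnegativity of \<open>\<gamma>\<close> is asked only at
  values of \<open>Shat\<close>, since that of the bracket rests on Hermitian symmetry.\<close>

lemma cond_exp_LW_numerator:
  assumes [measurable]: "\<gamma> \<in> borel_measurable borel" and \<gamma>: "\<And>\<omega>. 0 \<le> \<gamma> (Shat \<omega>)"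
  shows "AE \<omega> in M. cond_exp_given M Shat (\<lambda>\<omega>. \<gamma> (Shat \<omega>) * LW_numerator K (\<lambda>k. J k \<omega>)) \<omega>
    = \<gamma> (Shat \<omega>) * RB_numerator K (Shat \<omega>)"
proof -
  define v where "v A = 1 + (rtrace A)\<^sup>2" for A :: "complex^'p^'p"
  have v_pos: "0 < v A" for A
    by (simp add: v_def add_pos_nonneg)
  have [measurable]: "v \<in> borel_measurable borel"
    unfolding v_def[abs_def] by measurable
  let ?L = "\<lambda>\<omega>. LW_numerator K (\<lambda>k. J k \<omega>)" and ?R = "\<lambda>\<omega>. RB_numerator K (Shat \<omega>)"
  have cancel: "ennreal (\<gamma> (Shat \<omega>) * v (Shat \<omega>)) * ennreal (r / v (Shat \<omega>)) = ennreal (\<gamma> (Shat \<omega>) * r)"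
    for \<omega> r
    using v_pos[of "Shat \<omega>"] \<gamma>[of \<omega>] by (subst ennreal_mult'[symmetric]) auto
  have "AE \<omega> in M. ennreal (?R \<omega> / v (Shat \<omega>))
      = nn_cond_exp M Shat_algebra (\<lambda>\<omega>. ennreal (?L \<omega> / v (Shat \<omega>))) \<omega>"
  proof (rule cond.nn_cond_exp_charact)
    fix A assume "A \<in> sets Shat_algebra"
    then obtain B where B [measurable]: "B \<in> sets borel" and A: "A = Shat -` B \<inter> space M"
      by (auto simp: sets_vimage_algebra2)
    \<comment> \<open>Events of the generated algebra are preimages of Borel sets \<open>B\<close>,
      so restricting to them is weighting by a function of \<open>Shat\<close>; division by
      \<open>v\<close> gives the bound 1 on \<open>u\<close> times the squared trace.\<close>
    define u where "u X = indicator B X / v X" for X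
    have "(\<integral>\<^sup>+\<omega>. ennreal (u (Shat \<omega>) * ?L \<omega>) \<partial>M) = (\<integral>\<^sup>+\<omega>. ennreal (u (Shat \<omega>) * ?R \<omega>) \<partial>M)"
    proof (rule nn_integral_LW_numerator)
      show "u \<in> borel_measurable borel"
        unfolding u_def[abs_def] by measurable
      show "0 \<le> u X" for X
        using v_pos[of X] by (simp add: u_def)
      show "u X * (rtrace X)\<^sup>2 \<le> 1" for X
        using v_pos[of X] by (auto simp: u_def v_def indicator_def divide_le_eq)
    qed
    moreover have "ennreal (u (Shat \<omega>) * r) = ennreal (r / v (Shat \<omega>)) * indicator A \<omega>"
      if "\<omega> \<in> space M" for \<omega> r
      using that by (auto simp: u_def A indicator_def)
    ultimately show "(\<integral>\<^sup>+\<omega>\<in>A. ennreal (?L \<omega> / v (Shat \<omega>)) \<partial>M) = (\<integral>\<^sup>+\<omega>\<in>A. ennreal (?R \<omega> / v (Shat \<omega>)) \<partial>M)"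
      by (simp cong: nn_integral_cong_simp)
  qed measurable
  moreover have "AE \<omega> in M. ennreal (\<gamma> (Shat \<omega>) * v (Shat \<omega>))
        * nn_cond_exp M Shat_algebra (\<lambda>\<omega>. ennreal (?L \<omega> / v (Shat \<omega>))) \<omega>
      = nn_cond_exp M Shat_algebra (\<lambda>\<omega>. ennreal (\<gamma> (Shat \<omega>) * v (Shat \<omega>)) * ennreal (?L \<omega> / v (Shat \<omega>))) \<omega>"
    by (rule cond.nn_cond_exp_prod) measurable
  \<comment> \<open>\<open>real_cond_exp\<close> subtracts the conditional expectation of the
    negative part, which vanishes for a nonnegative function.\<close>
  moreover have "AE \<omega> in M. 0 = nn_cond_exp M Shat_algebra (\<lambda>\<omega>. ennreal (- (\<gamma> (Shat \<omega>) * ?L \<omega>))) \<omega>"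
  proof -
    have "(\<lambda>\<omega>. ennreal (- (\<gamma> (Shat \<omega>) * ?L \<omega>))) = (\<lambda>_. 0)"
      using \<gamma> by (auto simp: ennreal_neg LW_numerator_nonneg)
    then show ?thesis
      using cond.nn_cond_exp_F_meas[of "\<lambda>_. 0"] by simp
  qed
  ultimately show ?thesis
  proof eventually_elim
    case (elim \<omega>)
    have "nn_cond_exp M Shat_algebra (\<lambda>\<omega>. ennreal (\<gamma> (Shat \<omega>) * ?L \<omega>)) \<omega> = ennreal (\<gamma> (Shat \<omega>) * ?R \<omega>)"
      using elim(2) unfolding elim(1)[symmetric] cancel by simp
    then show ?case
      using \<gamma>[of \<omega>] elim(3)[symmetric]
      by (simp add: cond_exp_given_def real_cond_exp_def RB_numerator_nonneg)
  qed
qed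

end

theorem theorem3:
  fixes M :: "'a measure"
    and J :: "nat \<Rightarrow> 'a \<Rightarrow> complex^'p"
    and N :: "(complex^'p) measure"
    and S :: "complex^'p^'p"
    and K :: nat
  defines "Shat \<equiv> \<lambda>\<omega>. sample_cov K (\<lambda>k. J k \<omega>)"
  assumes "prob_space M"
    and "K \<ge> 1"
    and "hermitian_psd S"
    and "circular_complex_gaussian N S"
    and "prob_space.indep_vars M (\<lambda>_. borel) J {..<K}"
    and "\<And>k. k < K \<Longrightarrow> distr M borel (J k) = N"
  shows "AE \<omega> in M. LW_bracket (Shat \<omega>) \<noteq> 0 \<longrightarrow>
      cond_exp_given M Shat (\<lambda>\<omega>. rho_LW K (\<lambda>k. J k \<omega>)) \<omega> =
        cond_exp_given M Shat (\<lambda>\<omega>. LW_numerator K (\<lambda>k. J k \<omega>)) \<omega> /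
          ((real K)\<^sup>2 * LW_bracket (Shat \<omega>)) \<and>
      cond_exp_given M Shat (\<lambda>\<omega>. rho_LW K (\<lambda>k. J k \<omega>)) \<omega> =
        ((rtrace (Shat \<omega>))\<^sup>2 - rtrace (Shat \<omega> ** Shat \<omega>) / real K) /
          ((real K + 1) * LW_bracket (Shat \<omega>))"
proof -
  interpret snapshots: gaussian_snapshots M J N S K
    using assms by (auto intro!: gaussian_snapshots.intro gaussian_snapshots_axioms.intro)
  \<comment> \<open>The factor that turns \<open>LW_numerator\<close> into \<open>rho_LW\<close>.
    Where the bracket vanishes its value is 0, so it is nonnegative at every Hermitian
    matrix.\<close>
  let ?\<gamma> = "\<lambda>A :: complex^'p^'p. 1 / ((real K)\<^sup>2 * LW_bracket A)"
  have "AE \<omega> in M. cond_exp_given M Shat (\<lambda>\<omega>. ?\<gamma> (Shat \<omega>) * LW_numerator K (\<lambda>k. J k \<omega>)) \<omega>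
      = ?\<gamma> (Shat \<omega>) * RB_numerator K (Shat \<omega>)"
    unfolding Shat_def
    by (rule snapshots.cond_exp_LW_numerator) (simp_all add: LW_bracket_nonneg hermitian_sample_cov)
  \<comment> \<open>The factor 1 gives the conditional expectation of the numerator alone, needed
    for the quotient form of the parameter.\<close>
  moreover have "AE \<omega> in M. cond_exp_given M Shat (\<lambda>\<omega>. 1 * LW_numerator K (\<lambda>k. J k \<omega>)) \<omega>
      = 1 * RB_numerator K (Shat \<omega>)"
    unfolding Shat_def by (rule snapshots.cond_exp_LW_numerator) simp_all
  moreover have rho: "(\<lambda>\<omega>. rho_LW K (\<lambda>k. J k \<omega>)) = (\<lambda>\<omega>. ?\<gamma> (Shat \<omega>) * LW_numerator K (\<lambda>k. J k \<omega>))"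
    by (simp add: rho_LW_def Shat_def)
  ultimately show ?thesis
    unfolding rho
  proof eventually_elim
    case (elim \<omega>)
    have "?\<gamma> (Shat \<omega>) * RB_numerator K (Shat \<omega>) = ((rtrace (Shat \<omega>))\<^sup>2 - rtrace (Shat \<omega> ** Shat \<omega>) / real K) /
          ((real K + 1) * LW_bracket (Shat \<omega>))"
      using \<open>K \<ge> 1\<close> by (simp add: RB_numerator_def)
    then show ?case
      using elim by simp
  qed
qed

end
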